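(* Let $m$ and $K$ be strictly positive integers, let $(\mathcal H_i)_{1\leq i\leq m}$ and $(\mathcal G_k)_{1\leq k\leq K}$ be real Hilbert spaces, and set $\mathcal K=\mathcal H_1\oplus\cdots\oplus\mathcal H_m\oplus\mathcal G_1\oplus\cdots\oplus\mathcal G_K$. For every $i\in\{1,\ldots,m\}$ and every $k\in\{1,\ldots,K\}$, let $f_i\in\Gamma_0(\mathcal H_i)$ and $g_k\in\Gamma_0(\mathcal G_k)$, let $z_i\in\mathcal H_i$, let $r_k\in\mathcal G_k$, and let $L_{ki}\colon\mathcal H_i\to\mathcal G_k$ be linear and bounded. Let $(x_{1,0},\ldots,x_{m,0},v_{1,0}^*,\ldots,v_{K,0}^* )\in\mathcal K$ and assume that $$(\forall i\in\{1,\ldots,m\})\quad z_i\in\operatorname{ran}\bigg(\partial f_i+\sum_{k=1}^KL_{ki}^*\circ\partial g_k\circ\bigg(\sum_{j=1}^mL_{kj}\cdot-r_k\bigg)\bigg).$$ Consider the primal problem $$\underset{x_1\in\mathcal H_1,\ldots,x_m\in\mathcal H_m}{\text{minimize}}\ \sum_{i=1}^m\big(f_i(x_i)-\langle x_i\mid z_i\rangle\big)+\sum_{k=1}^Kg_k\Big(\sum_{i=1}^mL_{ki}x_i-r_k\Big)\qquad(\mathrm P)$$ and the dual problem $$\underset{v_1^*\in\mathcal G_1,\ldots,v_K^*\in\mathcal G_K}{\text{minimize}}\ \sum_{i=1}^mf_i^*\Big(z_i-\sum_{k=1}^KL_{ki}^*v_k^*\Big)+\sum_{k=1}^K\big(g_k^*(v_k^*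 )+\langle v_k^*\mid r_k\rangle\big).\qquad(\mathrm D)$$ Let $Z$ (the Kuhn-Tucker set) be the set of all $(x_1,\ldots,x_m,v_1^*,\ldots,v_K^* )\in\mathcal K$ such that $$(\forall i\in\{1,\ldots,m\})\ \ z_i-\sum_{k=1}^KL_{ki}^*v_k^*\in\partial f_i(x_i)\qquad\text{and}\qquad(\forall k\in\{1,\ldots,K\})\ \ \sum_{i=1}^mL_{ki}x_i-r_k\in\partial g_k^*(v_k^* ),$$ and let $(\overline x_1,\ldots,\overline x_m,\overline v_1^*,\ldots,\overline v_K^* )$ be the best approximation to $(x_{1,0},\ldots,x_{m,0},v_{1,0}^*,\ldots,v_{K,0}^* )$ from $Z$. Let $\varepsilon\in\,]0,1[$ and iterate for $n=0,1,\ldots$ (with $i$ ranging over $\{1,\ldots,m\}$ and $k$ over $\{1,\ldots,K\}$): 1. Take any $(\gamma_n,\mu_n)\in[\varepsilon,1/\varepsilon]^2$. For every $i$, set $a_{i,n}=\mathrm{prox}_{\gamma_nf_i}\big(x_{i,n}+\gamma_n(z_i-\sum_{k=1}^KL_{ki}^*v_{k,n}^* )\big)$. For every $k$, set $l_{k,n}=\sum_{i=1}^mL_{ki}x_{i,n}$, $b_{k,n}=r_k+\mathrm{prox}_{\mu_ng_k}(l_{k,n}+\mu_nv_{k,n}^*-r_k)$, $t_{k,n}=b_{k,n}-\sum_{i=1}^mL_{ki}a_{i,n}$. For every $i$, set $s_{i,n}^*=\gamma_n^{-1}(x_{i,n}-a_{i,n})+\mu_n^{-1}\sum_{k=1}^KL_{ki}^*(l_{k,n}-b_{k,n})$.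 Set $\tau_n=\sum_{i=1}^m\|s_{i,n}^*\|^2+\sum_{k=1}^K\|t_{k,n}\|^2$. 2. If $\tau_n=0$, set $\theta_n=0$. If $\tau_n>0$, take any $\lambda_n\in[\varepsilon,1]$ and set $\theta_n=\lambda_n\big(\gamma_n^{-1}\sum_{i=1}^m\|x_{i,n}-a_{i,n}\|^2+\mu_n^{-1}\sum_{k=1}^K\|l_{k,n}-b_{k,n}\|^2\big)/\tau_n$. 3. For every $i$, set $x_{i,n+1/2}=x_{i,n}-\theta_ns_{i,n}^*$. For every $k$, set $v_{k,n+1/2}^*=v_{k,n}^*-\theta_nt_{k,n}$. 4. Set $\chi_n=\sum_{i=1}^m\langle x_{i,0}-x_{i,n}\mid x_{i,n}-x_{i,n+1/2}\rangle+\sum_{k=1}^K\langle v_{k,0}^*-v_{k,n}^*\mid v_{k,n}^*-v_{k,n+1/2}^*\rangle$, $\omega_n=\sum_{i=1}^m\|x_{i,0}-x_{i,n}\|^2+\sum_{k=1}^K\|v_{k,0}^*-v_{k,n}^*\|^2$, $\nu_n=\sum_{i=1}^m\|x_{i,n}-x_{i,n+1/2}\|^2+\sum_{k=1}^K\|v_{k,n}^*-v_{k,n+1/2}^*\|^2$, $\rho_n=\omega_n\nu_n-\chi_n^2$. 5. If $\rho_n=0$ and $\chi_n\geq0$, set, for all $i$ and $k$, $x_{i,n+1}=x_{i,n+1/2}$ and $v_{k,n+1}^*=v_{k,n+1/2}^*$. If $\rho_n>0$ and $\chi_n\nu_n\geq\rho_n$, set, for all $i$ and $k$, $x_{i,n+1}=x_{i,0}+(1+\chi_n/\nu_n)(x_{i,n+1/2}-x_{i,n})$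 and $v_{k,n+1}^*=v_{k,0}^*+(1+\chi_n/\nu_n)(v_{k,n+1/2}^*-v_{k,n}^* )$. If $\rho_n>0$ and $\chi_n\nu_n<\rho_n$, set, for all $i$ and $k$, $x_{i,n+1}=x_{i,n}+(\nu_n/\rho_n)\big(\chi_n(x_{i,0}-x_{i,n})+\omega_n(x_{i,n+1/2}-x_{i,n})\big)$ and $v_{k,n+1}^*=v_{k,n}^*+(\nu_n/\rho_n)\big(\chi_n(v_{k,0}^*-v_{k,n}^* )+\omega_n(v_{k,n+1/2}^*-v_{k,n}^* )\big)$. Then the following hold: (i) $(\overline x_1,\ldots,\overline x_m)$ solves $(\mathrm P)$ and $(\overline v_1^*,\ldots,\overline v_K^* )$ solves $(\mathrm D)$. (ii) For every $i\in\{1,\ldots,m\}$, $x_{i,n}\to\overline x_i$ strongly. (iii) For every $k\in\{1,\ldots,K\}$, $v_{k,n}^*\to\overline v_k^*$ strongly.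
   Context: $\oplus$ denotes the Hilbert direct sum. For a real Hilbert space $\mathcal H$, $\Gamma_0(\mathcal H)$ is the class of proper lower semicontinuous convex functions from $\mathcal H$ to $]-\infty,+\infty]$. For $f\in\Gamma_0(\mathcal H)$, the conjugate is $f^*(u^* )=\sup_{x\in\mathcal H}(\langle x\mid u^*\rangle-f(x))$, the subdifferential is $\partial f(x)=\{u^*\in\mathcal H : (\forall y\in\mathcal H)\ \langle y-x\mid u^*\rangle+f(x)\leq f(y)\}$, and the proximity operator $\mathrm{prox}_f$ maps every $x\in\mathcal H$ to the unique minimizer of $y\mapsto f(y)+\|x-y\|^2/2$. $L_{ki}^*$ is the adjoint of $L_{ki}$. $\operatorname{ran}$ denotes the range of a set-valued operator, i.e., the union of its values; in the range assumption, the operator for index $i$ is the set-valued operator $(x_1,\ldots,x_m)\mapsto\partial f_i(x_i)+\sum_{k=1}^KL_{ki}^*\big(\partial g_k(\sum_{j=1}^mL_{kj}x_j-r_k)\big)$, where $L_{ki}^*(S)$ is the image of a set $S$ and sums of sets are Minkowski sums. The best approximation to a point from $Z$ is its projection onto $Z$, i.e., the point of $Z$ nearest to it.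
   Formalization: The existence of the best approximation from Z (equivalently, that Z is nonempty) is taken as a hypothesis, because the range assumption, read separately for each i, does not guarantee that Z is nonempty. *)

theory Defs
  imports "HOL-Analysis.Analysis"
begin

(* A finite family of real Hilbert spaces H_1, ..., H_m cannot be a family of types.  It is
   rendered as a family of complete linear subspaces of one ambient real inner product space.
   This loses no generality, because any finite family of Hilbert spaces embeds isometrically
   in its Hilbert direct sum.  All notions below are relative to such a carrier: functions
   and operators are only ever looked at on it, and values outside it are irrelevant. *)
definition hilbert_carrier :: "'a::real_inner set \<Rightarrow> bool" where
  "hilbert_carrier H \<longleftrightarrow> subspace H \<and> complete H"

(* Elements are pairs of tuples ((x_1,...,x_m), (v_1,...,v_K)); tuples are extensional
   functions, so that a tuple is determined by its components. *)
definition direct_sum ::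
  "nat \<Rightarrow> nat \<Rightarrow> (nat \<Rightarrow> 'a::real_inner set) \<Rightarrow> (nat \<Rightarrow> 'b::real_inner set)
    \<Rightarrow> ((nat \<Rightarrow> 'a) \<times> (nat \<Rightarrow> 'b)) set" where
  "direct_sum m K H G = (\<Pi>\<^sub>E i\<in>{1..m}. H i) \<times> (\<Pi>\<^sub>E k\<in>{1..K}. G k)"

definition direct_sum_dist ::
  "nat \<Rightarrow> nat \<Rightarrow> (nat \<Rightarrow> 'a::real_inner) \<times> (nat \<Rightarrow> 'b::real_inner)
    \<Rightarrow> (nat \<Rightarrow> 'a) \<times> (nat \<Rightarrow> 'b) \<Rightarrow> real" where
  "direct_sum_dist m K p q =
     sqrt ((\<Sum>i=1..m. (norm (fst p i - fst q i))\<^sup>2) + (\<Sum>k=1..K. (norm (snd p k - snd q k))\<^sup>2))"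

definition is_best_approx ::
  "nat \<Rightarrow> nat \<Rightarrow> ((nat \<Rightarrow> 'a::real_inner) \<times> (nat \<Rightarrow> 'b::real_inner)) set
    \<Rightarrow> (nat \<Rightarrow> 'a) \<times> (nat \<Rightarrow> 'b) \<Rightarrow> (nat \<Rightarrow> 'a) \<times> (nat \<Rightarrow> 'b) \<Rightarrow> bool" where
  "is_best_approx m K Z p q \<longleftrightarrow> is_arg_min (direct_sum_dist m K p) (\<lambda>w. w \<in> Z) q"

definition bounded_linear_between ::
  "'a::real_inner set \<Rightarrow> 'b::real_inner set \<Rightarrow> ('a \<Rightarrow> 'b) \<Rightarrow> bool" where
  "bounded_linear_between H G L \<longleftrightarrow>
     L ` H \<subseteq> G \<and>
     (\<forall>x\<in>H. \<forall>y\<in>H. L (x + y) = L x + L y) \<and>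
     (\<forall>c. \<forall>x\<in>H. L (c *\<^sub>R x) = c *\<^sub>R L x) \<and>
     (\<exists>B. \<forall>x\<in>H. norm (L x) \<le> B * norm x)"

definition adjoint_on :: "'a::real_inner set \<Rightarrow> ('a \<Rightarrow> 'b::real_inner) \<Rightarrow> 'b \<Rightarrow> 'a" where
  "adjoint_on H L y = (THE w. w \<in> H \<and> (\<forall>x\<in>H. inner (L x) y = inner x w))"

(* The library filter (at x within H) is punctured at x, which gives the same notion of
   lower semicontinuity at x as the unpunctured one. *)
definition Gamma0 :: "'a::real_inner set \<Rightarrow> ('a \<Rightarrow> ereal) set" where
  "Gamma0 H = {f.
     (\<forall>x\<in>H. f x \<noteq> -\<infinity>) \<and> (\<exists>x\<in>H. f x \<noteq> \<infinity>) \<and>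
     (\<forall>x\<in>H. f x \<le> Liminf (at x within H) f) \<and>
     (\<forall>x\<in>H. \<forall>y\<in>H. \<forall>t\<in>{0<..<1::real}.
        f ((1 - t) *\<^sub>R x + t *\<^sub>R y) \<le> ereal (1 - t) * f x + ereal t * f y)}"

definition conjugate :: "'a::real_inner set \<Rightarrow> ('a \<Rightarrow> ereal) \<Rightarrow> 'a \<Rightarrow> ereal" where
  "conjugate H f u = (SUP x\<in>H. ereal (inner x u) - f x)"

definition subdifferential :: "'a::real_inner set \<Rightarrow> ('a \<Rightarrow> ereal) \<Rightarrow> 'a \<Rightarrow> 'a set" where
  "subdifferential H f x = {u\<in>H. \<forall>y\<in>H. ereal (inner (y - x) u) + f x \<le> f y}"

definition prox :: "'a::real_inner set \<Rightarrow> ('a \<Rightarrow> ereal) \<Rightarrow> 'a \<Rightarrow> 'a" where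
  "prox H f x = (THE p. is_arg_min (\<lambda>y. f y + ereal ((norm (x - y))\<^sup>2 / 2)) (\<lambda>y. y \<in> H) p)"

definition ran_on :: "'c set \<Rightarrow> ('c \<Rightarrow> 'd set) \<Rightarrow> 'd set" where
  "ran_on D A = (\<Union>x\<in>D. A x)"

(* The sums of sets are the Minkowski sums of Set_Algebras.  Requiring z i to be in the range
   of this operator for each i separately does not make the Kuhn-Tucker set nonempty: the
   point x and the selections from the subdifferentials of the g k may depend on i.  Take
   m = 2, K = 1, all spaces the real line, f = 0, g the absolute value, L the identity, r = 0,
   z 1 = 1, z 2 = -1. *)
definition coupled_operator ::
  "nat \<Rightarrow> nat \<Rightarrow> (nat \<Rightarrow> 'a::real_inner set) \<Rightarrow> (nat \<Rightarrow> 'b::real_inner set)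
    \<Rightarrow> (nat \<Rightarrow> 'a \<Rightarrow> ereal) \<Rightarrow> (nat \<Rightarrow> 'b \<Rightarrow> ereal) \<Rightarrow> (nat \<Rightarrow> nat \<Rightarrow> 'a \<Rightarrow> 'b)
    \<Rightarrow> (nat \<Rightarrow> 'b) \<Rightarrow> nat \<Rightarrow> (nat \<Rightarrow> 'a) \<Rightarrow> 'a set" where
  "coupled_operator m K H G f g L r i x =
     subdifferential (H i) (f i) (x i)
     + (\<Sum>k=1..K. adjoint_on (H i) (L k i)
          ` subdifferential (G k) (g k) ((\<Sum>j=1..m. L k j (x j)) - r k))"

definition primal_objective ::
  "nat \<Rightarrow> nat \<Rightarrow> (nat \<Rightarrow> 'a::real_inner \<Rightarrow> ereal) \<Rightarrow> (nat \<Rightarrow> 'b::real_inner \<Rightarrow> ereal)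
    \<Rightarrow> (nat \<Rightarrow> nat \<Rightarrow> 'a \<Rightarrow> 'b) \<Rightarrow> (nat \<Rightarrow> 'a) \<Rightarrow> (nat \<Rightarrow> 'b) \<Rightarrow> (nat \<Rightarrow> 'a) \<Rightarrow> ereal" where
  "primal_objective m K f g L z r x =
     (\<Sum>i=1..m. f i (x i) - ereal (inner (x i) (z i)))
     + (\<Sum>k=1..K. g k ((\<Sum>i=1..m. L k i (x i)) - r k))"

definition dual_objective ::
  "nat \<Rightarrow> nat \<Rightarrow> (nat \<Rightarrow> 'a::real_inner set) \<Rightarrow> (nat \<Rightarrow> 'b::real_inner set)
    \<Rightarrow> (nat \<Rightarrow> 'a \<Rightarrow> ereal) \<Rightarrow> (nat \<Rightarrow> 'b \<Rightarrow> ereal) \<Rightarrow> (nat \<Rightarrow> nat \<Rightarrow> 'a \<Rightarrow> 'b)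
    \<Rightarrow> (nat \<Rightarrow> 'a) \<Rightarrow> (nat \<Rightarrow> 'b) \<Rightarrow> (nat \<Rightarrow> 'b) \<Rightarrow> ereal" where
  "dual_objective m K H G f g L z r v =
     (\<Sum>i=1..m. conjugate (H i) (f i) (z i - (\<Sum>k=1..K. adjoint_on (H i) (L k i) (v k))))
     + (\<Sum>k=1..K. conjugate (G k) (g k) (v k) + ereal (inner (v k) (r k)))"

definition solves_primal ::
  "nat \<Rightarrow> nat \<Rightarrow> (nat \<Rightarrow> 'a::real_inner set)
    \<Rightarrow> (nat \<Rightarrow> 'a \<Rightarrow> ereal) \<Rightarrow> (nat \<Rightarrow> 'b::real_inner \<Rightarrow> ereal)
    \<Rightarrow> (nat \<Rightarrow> nat \<Rightarrow> 'a \<Rightarrow> 'b) \<Rightarrow> (nat \<Rightarrow> 'a) \<Rightarrow> (nat \<Rightarrow> 'b) \<Rightarrow> (nat \<Rightarrow> 'a) \<Rightarrow> bool" where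
  "solves_primal m K H f g L z r x \<longleftrightarrow>
     is_arg_min (primal_objective m K f g L z r) (\<lambda>y. y \<in> (\<Pi>\<^sub>E i\<in>{1..m}. H i)) x"

definition solves_dual ::
  "nat \<Rightarrow> nat \<Rightarrow> (nat \<Rightarrow> 'a::real_inner set) \<Rightarrow> (nat \<Rightarrow> 'b::real_inner set)
    \<Rightarrow> (nat \<Rightarrow> 'a \<Rightarrow> ereal) \<Rightarrow> (nat \<Rightarrow> 'b \<Rightarrow> ereal) \<Rightarrow> (nat \<Rightarrow> nat \<Rightarrow> 'a \<Rightarrow> 'b)
    \<Rightarrow> (nat \<Rightarrow> 'a) \<Rightarrow> (nat \<Rightarrow> 'b) \<Rightarrow> (nat \<Rightarrow> 'b) \<Rightarrow> bool" where
  "solves_dual m K H G f g L z r v \<longleftrightarrow>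
     is_arg_min (dual_objective m K H G f g L z r) (\<lambda>w. w \<in> (\<Pi>\<^sub>E k\<in>{1..K}. G k)) v"

definition kuhn_tucker_set ::
  "nat \<Rightarrow> nat \<Rightarrow> (nat \<Rightarrow> 'a::real_inner set) \<Rightarrow> (nat \<Rightarrow> 'b::real_inner set)
    \<Rightarrow> (nat \<Rightarrow> 'a \<Rightarrow> ereal) \<Rightarrow> (nat \<Rightarrow> 'b \<Rightarrow> ereal) \<Rightarrow> (nat \<Rightarrow> nat \<Rightarrow> 'a \<Rightarrow> 'b)
    \<Rightarrow> (nat \<Rightarrow> 'a) \<Rightarrow> (nat \<Rightarrow> 'b) \<Rightarrow> ((nat \<Rightarrow> 'a) \<times> (nat \<Rightarrow> 'b)) set" where
  "kuhn_tucker_set m K H G f g L z r =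
     {(x, v) \<in> direct_sum m K H G.
        (\<forall>i\<in>{1..m}. z i - (\<Sum>k=1..K. adjoint_on (H i) (L k i) (v k))
            \<in> subdifferential (H i) (f i) (x i)) \<and>
        (\<forall>k\<in>{1..K}. (\<Sum>i=1..m. L k i (x i)) - r k
            \<in> subdifferential (G k) (conjugate (G k) (g k)) (v k))}"

end

theory Submission
  imports Defs
begin

text \<open>The Kuhn-Tucker set is the zero set of the sum of the maximally monotone operator
  \<open>\<partial>f \<times> \<partial>g\<^sup>*\<close> (suitably translated) and a skew linear operator, and each iteration produces a
  point \<open>(q, w)\<close> of the graph of this sum, hence a half-space that contains the Kuhn-Tucker set.
  Combining the projection onto it with Haugazeau's construction, the distances from the starting point
  \<open>p\<^sub>0\<close> to the iterates increase to some \<open>R\<close> that is at most the distance to the Kuhn-Tucker set, and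
  \<open>w\<close> and \<open>p - q\<close> tend to zero.

  Weak limits are avoided: the closed convex sets of approximate zeros at distance at most
  \<open>R + 1/j\<close> from \<open>p\<^sub>0\<close> are nested, bounded and nonempty, so they have a common point. It is a zero at
  distance at most \<open>R\<close>, which forces strong convergence to the best approximation.

  Since monotonicity tests against a skew summand cancel, no resolvent of the sum is needed: the
  proximal points of the individual functions suffice.\<close>

section \<open>Nested closed convex sets\<close>

text \<open>The pairing of \<open>p - q\<close> with \<open>w\<close> drives the estimates: the
  coupling terms cancel in it, and what remains is exactly the numerator of the step size. Since the
  parameters stay in \<open>[\<epsilon>, 1/\<epsilon>]\<close>, this quantity controls both
  \<open>p - q\<close> and \<open>w\<close> uniformly.

  A Haugazeau step projects the starting point onto an intersection of two half-spaces, so it needs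
  a common point of them. The best approximation, which the hypothesis \<open>best\<close> places in
  the Kuhn-Tucker set, is such a point at every iteration. It also identifies the limit: seen from
  \<open>p n\<close>, the directions to the starting point and to \<open>pbar\<close> form no acute
  angle, so the squared distance from \<open>p n\<close> to \<open>pbar\<close> is at most the
  amount by which the squared distances to the starting point still differ.

  Functions on the naturals carry no inner product. Tuples are therefore encoded as finitely
  supported sequences, which merges the finitely many spaces into one primal and one dual
  carrier.\<close>

lemma midpoint_parallelogram:
  fixes y w :: "'a::real_inner"
  shows "(norm (y - w))\<^sup>2 = 2 * (norm y)\<^sup>2 + 2 * (norm w)\<^sup>2 - 4 * (norm ((1/2) *\<^sub>R y + (1/2) *\<^sub>R w))\<^sup>2"
  by (simp add: power2_norm_eq_inner inner_add_left inner_add_right inner_diff_left inner_diff_right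
      inner_commute algebra_simps)

text \<open>This substitutes for weak compactness: the points of nearly minimal norm form a Cauchy sequence.\<close>

lemma nested_closed_convex_Inter_nonempty:
  fixes S :: "nat \<Rightarrow> 'a::real_inner set"
  assumes "complete X"
    and sub: "\<And>n. S n \<subseteq> X" and cl: "\<And>n. closed (S n)" and conv: "\<And>n. convex (S n)"
    and ne: "\<And>n. S n \<noteq> {}" and dec: "decseq S" and bdd: "\<And>n y. y \<in> S n \<Longrightarrow> norm y \<le> R"
  shows "(\<Inter>n. S n) \<noteq> {}"
proof -
  define d where "d n = Inf (norm ` S n)" for n
  have bb: "bdd_below (norm ` S n)" for n
    by (auto intro!: bdd_belowI[of _ 0])
  have d_le: "d n \<le> norm y" if "y \<in> S n" for n y
    unfolding d_def using that bb by (intro cInf_lower) auto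
  have d0: "0 \<le> d n" for n
    unfolding d_def using ne by (intro cInf_greatest) auto
  have "incseq d"
    unfolding incseq_def d_def using dec ne bb
    by (auto intro!: cInf_superset_mono simp: decseq_def image_mono)
  moreover have "d n \<le> R" for n
    using ne[of n] d_le bdd by (meson ex_in_conv order.trans)
  ultimately obtain D where D: "d \<longlonglongrightarrow> D"
    using incseq_convergent[of d R] by blast
  have "\<exists>y. y \<in> S n \<and> norm y < d n + 1 / real (Suc n)" for n
    using cInf_lessD[of "norm ` S n" "d n + 1 / real (Suc n)"] ne[of n] unfolding d_def by auto
  note near = someI_ex[OF this]
  define y where "y n = (SOME y. y \<in> S n \<and> norm y < d n + 1 / real (Suc n))" for n
  have y: "y n \<in> S n" and yd: "norm (y n) < d n + 1 / real (Suc n)" for n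
    using near[of n] by (simp_all only: y_def)
  have "(\<lambda>n. d n + 1 / real (Suc n)) \<longlonglongrightarrow> D + 0"
    by (intro tendsto_intros D LIMSEQ_Suc lim_1_over_n)
  then have upper: "(\<lambda>n. d n + 1 / real (Suc n)) \<longlonglongrightarrow> D"
    by simp
  have yD: "(\<lambda>n. norm (y n)) \<longlonglongrightarrow> D"
  proof (rule tendsto_sandwich[OF _ _ D upper])
    show "\<forall>\<^sub>F n in sequentially. d n \<le> norm (y n)"
      using d_le[OF y] by simp
    show "\<forall>\<^sub>F n in sequentially. norm (y n) \<le> d n + 1 / real (Suc n)"
      using yd by (intro always_eventually allI less_imp_le)
  qed
  have "Cauchy y"
  proof (rule metric_CauchyI)
    fix e :: real assume "0 < e"
    \<comment> \<open>Two squared norms below \<open>D\<^sup>2 + e'\<close> and a squared midpoint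
      norm of at least \<open>(d N)\<^sup>2 > D\<^sup>2 - e'\<close> leave a squared distance below
      \<open>8 * e'\<close>. The midpoint lies in \<open>S N\<close> by convexity.\<close>
    define e' where "e' = e\<^sup>2 / 8"
    have "e' > 0"
      using \<open>0 < e\<close> by (simp add: e'_def)
    have "(\<lambda>n. (norm (y n))\<^sup>2) \<longlonglongrightarrow> D\<^sup>2" "(\<lambda>n. (d n)\<^sup>2) \<longlonglongrightarrow> D\<^sup>2"
      by (intro tendsto_intros yD D)+
    then have "\<forall>\<^sub>F n in sequentially. (norm (y n))\<^sup>2 < D\<^sup>2 + e' \<and> D\<^sup>2 - e' < (d n)\<^sup>2"
      using \<open>e' > 0\<close> by (intro eventually_conj order_tendstoD[of _ "D\<^sup>2"]) simp_all
    then obtain N where N: "\<And>n. n \<ge> N \<Longrightarrow> (norm (y n))\<^sup>2 < D\<^sup>2 + e'" "(d N)\<^sup>2 > D\<^sup>2 - e'"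
      by (auto simp: eventually_sequentially)
    have "dist (y j) (y k) < e" if "j \<ge> N" "k \<ge> N" for j k
    proof -
      have "y j \<in> S N" "y k \<in> S N"
        using y dec that by (auto simp: decseq_def)
      then have "(1/2) *\<^sub>R y j + (1/2) *\<^sub>R y k \<in> S N"
        using conv[of N] by (intro convexD) auto
      then have "(d N)\<^sup>2 \<le> (norm ((1/2) *\<^sub>R y j + (1/2) *\<^sub>R y k))\<^sup>2"
        using d_le d0 by (intro power_mono) auto
      then have "(norm (y j - y k))\<^sup>2 < e\<^sup>2"
        using N(1)[OF that(1)] N(1)[OF that(2)] N(2) midpoint_parallelogram[of "y j" "y k"]
        by (simp add: e'_def)
      then show ?thesis
        using \<open>0 < e\<close> by (simp add: dist_norm power_less_imp_less_base)
    qed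
    then show "\<exists>M. \<forall>m\<ge>M. \<forall>n\<ge>M. dist (y m) (y n) < e"
      by blast
  qed
  then obtain c where c: "y \<longlonglongrightarrow> c"
    using \<open>complete X\<close> y sub by (meson completeE subsetD)
  have "c \<in> S n" for n
  proof (rule Lim_in_closed_set[OF cl _ _ c])
    show "\<forall>\<^sub>F k in sequentially. y k \<in> S n"
      using y dec by (auto simp: decseq_def intro!: eventually_sequentiallyI[of n])
  qed auto
  then show ?thesis
    by blast
qed

section \<open>Convex analysis on a Hilbert carrier\<close>

lemma Gamma0_lsc:
  assumes "f \<in> Gamma0 H" "x \<in> H" "C < f x"
  obtains d where "d > 0" "\<And>y. y \<in> H \<Longrightarrow> dist y x < d \<Longrightarrow> C < f y"
proof -
  have "f x \<le> Liminf (at x within H) f"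
    using assms by (auto simp: Gamma0_def)
  then have "\<forall>\<^sub>F y in at x within H. C < f y"
    using assms(3) by (auto simp: le_Liminf_iff)
  then obtain d where "d > 0" "\<And>y. y \<in> H \<Longrightarrow> y \<noteq> x \<Longrightarrow> dist y x < d \<Longrightarrow> C < f y"
    by (auto simp: eventually_at)
  \<comment> \<open>The filter is punctured at \<open>x\<close>; the point itself is covered by
    \<open>C < f x\<close>.\<close>
  then show ?thesis
    using that assms(3) by metis
qed

text \<open>The bound varies along the sequence because a sublevel set of a proximal objective reads
  \<open>f y \<le> (e - (norm (x - y))\<^sup>2 / 2) / \<gamma>\<close>, whose right-hand side
  depends on \<open>y\<close>.\<close>

lemma Gamma0_seq_closed:
  assumes "f \<in> Gamma0 H" "x \<in> H" "\<And>n. y n \<in> H" "y \<longlonglongrightarrow> x" "c \<longlonglongrightarrow> l" "\<And>n. f (y n) \<le> ereal (c n)"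
  shows "f x \<le> ereal l"
proof (rule ccontr)
  assume "\<not> ?thesis"
  then obtain C where C: "ereal l < ereal C" "ereal C < f x"
    using ereal_dense2[of "ereal l" "f x"] by (auto simp: not_le)
  obtain d where d: "d > 0" "\<And>y. y \<in> H \<Longrightarrow> dist y x < d \<Longrightarrow> ereal C < f y"
    using Gamma0_lsc[OF assms(1,2) C(2)] by blast
  have "\<forall>\<^sub>F n in sequentially. dist (y n) x < d" "\<forall>\<^sub>F n in sequentially. c n < C"
    using assms(4,5) d(1) C(1) by (auto simp: tendsto_iff[of y] elim: order_tendstoD)
  then have "\<forall>\<^sub>F n in sequentially. False"
  proof eventually_elim
    case (elim n)
    have "ereal C < ereal (c n)"
      using d(2)[OF assms(3) elim(1)] assms(6)[of n] by (rule order.strict_trans2)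
    then show False
      using elim(2) by simp
  qed
  then show False
    by simp
qed

lemma Gamma0_real_of_ereal:
  assumes "f \<in> Gamma0 H" "x \<in> H" "f x \<noteq> \<infinity>"
  shows "f x = ereal (real_of_ereal (f x))"
  using assms by (cases "f x") (auto simp: Gamma0_def)

text \<open>Real upper bounds stand in for the values, which keeps infinite values out of the later
  arithmetic. The ends of the segment, excluded in \<open>Gamma0\<close>, are included.\<close>

lemma Gamma0_convex:
  assumes "f \<in> Gamma0 H" "x \<in> H" "y \<in> H" "f x \<le> ereal c" "f y \<le> ereal d" "0 \<le> u" "u \<le> 1"
  shows "f ((1 - u) *\<^sub>R x + u *\<^sub>R y) \<le> ereal ((1 - u) * c + u * d)"
proof -
  consider "u = 0" | "u = 1" | "u \<in> {0<..<1}"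
    using assms(6,7) by fastforce
  then show ?thesis
  proof cases
    case 3
    then have "f ((1 - u) *\<^sub>R x + u *\<^sub>R y) \<le> ereal (1 - u) * f x + ereal u * f y"
      using assms by (auto simp: Gamma0_def)
    also have "\<dots> \<le> ereal (1 - u) * ereal c + ereal u * ereal d"
      using 3 assms by (intro add_mono ereal_mult_left_mono) auto
    finally show ?thesis
      by simp
  qed (use assms in auto)
qed

text \<open>Lower semicontinuity at a point of the domain gives a bound on a small ball, and convexity
  extends it along rays. This avoids the Hahn-Banach theorem.\<close>

lemma Gamma0_lower_bound:
  assumes "f \<in> Gamma0 H" "hilbert_carrier H"
  obtains x0 c B where "x0 \<in> H" "B \<ge> 0" "\<And>y. y \<in> H \<Longrightarrow> ereal (c - B * norm (y - x0)) \<le> f y"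
proof -
  have H: "subspace H"
    using assms(2) by (simp add: hilbert_carrier_def)
  obtain x0 where x0: "x0 \<in> H" "f x0 \<noteq> \<infinity>"
    using assms by (auto simp: Gamma0_def)
  define c where "c = real_of_ereal (f x0)"
  have fc: "f x0 = ereal c"
    unfolding c_def by (rule Gamma0_real_of_ereal[OF assms(1) x0])
  have "ereal (c - 1) < f x0"
    by (simp add: fc)
  then obtain d where d: "d > 0" "\<And>y. y \<in> H \<Longrightarrow> dist y x0 < d \<Longrightarrow> ereal (c - 1) < f y"
    using Gamma0_lsc[OF assms(1) x0(1)] by blast
  have "ereal (c - 1 - (2 / d) * norm (y - x0)) \<le> f y" if "y \<in> H" for y
  proof (cases "dist y x0 < d")
    case True
    have "ereal (c - 1 - (2 / d) * norm (y - x0)) \<le> ereal (c - 1)"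
      using d by simp
    also have "\<dots> \<le> f y"
      using d(2)[OF that True] by simp
    finally show ?thesis .
  next
    case False
    \<comment> \<open>This weight puts \<open>?w\<close> at distance \<open>d / 2\<close> from
      \<open>x0\<close>, where \<open>f\<close> exceeds \<open>c - 1\<close>. Convexity then gives a
      value above \<open>c - 1 / u\<close> at \<open>y\<close>, and \<open>1 / u\<close> is
      \<open>(2 / d) * norm (y - x0)\<close>.\<close>
    define u where "u = d / (2 * norm (y - x0))"
    have pos: "norm (y - x0) > 0"
      using False d(1) by (auto simp: dist_norm)
    have u: "0 < u" "u \<le> 1"
      using False d(1) pos by (auto simp: u_def dist_norm field_simps)
    let ?w = "(1 - u) *\<^sub>R x0 + u *\<^sub>R y"
    have "?w - x0 = u *\<^sub>R (y - x0)"
      by (simp add: algebra_simps)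
    then have "dist ?w x0 = d / 2"
      using d(1) pos by (simp add: dist_norm u_def)
    moreover have "?w \<in> H"
      using H that x0 by (simp add: subspace_add subspace_scale)
    ultimately have lo: "ereal (c - 1) < f ?w"
      using d by simp
    show ?thesis
    proof (cases "f y = \<infinity>")
      case fin: False
      define e where "e = real_of_ereal (f y)"
      have fe: "f y = ereal e"
        unfolding e_def by (rule Gamma0_real_of_ereal[OF assms(1) that fin])
      have "f ?w \<le> ereal ((1 - u) * c + u * e)"
        using u by (intro Gamma0_convex[OF assms(1) x0(1) that]) (auto simp: fc fe)
      then have "c - 1 < (1 - u) * c + u * e"
        using lo by (metis less_ereal.simps(1) order_less_le_trans)
      then have "u * (c - 1 / u) < u * e"
        using u by (simp add: algebra_simps)
      then have "c - 1 / u < e"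
        using u by simp
      then have "c - (2 / d) * norm (y - x0) < e"
        by (simp add: u_def field_simps)
      then show ?thesis
        by (simp add: fe)
    qed simp
  qed
  then show ?thesis
    using that[of x0 "2 / d" "c - 1"] x0 d(1) by simp
qed

section \<open>Subdifferentials and their monotonicity\<close>

lemma subdifferentialI:
  assumes "u \<in> H" "\<And>y. y \<in> H \<Longrightarrow> ereal (inner (y - x) u) + f x \<le> f y"
  shows "u \<in> subdifferential H f x"
  using assms by (simp add: subdifferential_def)

lemma subdifferentialD:
  assumes "u \<in> subdifferential H f x" "y \<in> H"
  shows "ereal (inner (y - x) u) + f x \<le> f y"
  using assms by (simp add: subdifferential_def)

text \<open>An infinite value at \<open>x\<close> would make the subgradient inequality force
  \<open>f\<close> to be infinite on all of \<open>H\<close>. Finiteness is what allows values to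
  cancel when two subgradient inequalities are added.\<close>

lemma subdifferential_finite:
  assumes "f \<in> Gamma0 H" "x \<in> H" "u \<in> subdifferential H f x"
  obtains c where "f x = ereal c"
proof -
  obtain y where "y \<in> H" "f y \<noteq> \<infinity>"
    using assms by (auto simp: Gamma0_def)
  moreover have "ereal (inner (y - x) u) + f x \<le> f y"
    using assms \<open>y \<in> H\<close> by (simp add: subdifferential_def)
  ultimately have "f x \<noteq> \<infinity>"
    by auto
  then show ?thesis
    using Gamma0_real_of_ereal[OF assms(1,2)] that by blast
qed

lemma subdifferential_monotone:
  assumes "f \<in> Gamma0 H" "x \<in> H" "y \<in> H" "u \<in> subdifferential H f x" "w \<in> subdifferential H f y"
  shows "0 \<le> inner (x - y) (u - w)"
proof -
  obtain c d where "f x = ereal c" "f y = ereal d"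
    using subdifferential_finite assms by metis
  moreover have "ereal (inner (y - x) u) + f x \<le> f y" "ereal (inner (x - y) w) + f y \<le> f x"
    using assms by (auto simp: subdifferential_def)
  ultimately have "inner (y - x) u + c \<le> d" "inner (x - y) w + d \<le> c"
    by auto
  then show ?thesis
    by (simp add: inner_diff_left inner_diff_right algebra_simps)
qed

section \<open>Proximity operators\<close>

lemma norm_diff_segment_sq:
  fixes x p y :: "'a::real_inner"
  shows "(norm (x - ((1 - u) *\<^sub>R p + u *\<^sub>R y)))\<^sup>2
    = (norm (x - p))\<^sup>2 - 2 * u * inner (x - p) (y - p) + u\<^sup>2 * (norm (y - p))\<^sup>2"
  unfolding power2_norm_eq_inner
  by (simp add: inner_add_left inner_add_right inner_diff_left inner_diff_right inner_commute
      algebra_simps power2_eq_square)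

text \<open>Isolates \<open>f\<close>, so that convexity and closedness of \<open>f\<close> itself
  can be applied to sublevel sets of the proximal objective.\<close>

lemma prox_objective_le_iff:
  assumes "\<gamma> > 0"
  shows "ereal \<gamma> * f y + ereal q \<le> ereal c \<longleftrightarrow> f y \<le> ereal ((c - q) / \<gamma>)"
  using assms by (cases "f y") (auto simp: field_simps)

text \<open>First-order optimality along the segment from \<open>p\<close> to \<open>y\<close>:
  after division by the step \<open>u\<close>, the quadratic part contributes only
  \<open>u * (norm (y - p))\<^sup>2 / 2\<close>, which vanishes as \<open>u\<close> tends to
  zero.\<close>

lemma prox_minimizer_subdifferential:
  assumes f: "f \<in> Gamma0 H" and H: "hilbert_carrier H" and "\<gamma> > 0" and x: "x \<in> H"
    and p: "p \<in> H"
      "\<And>y. y \<in> H \<Longrightarrow> ereal \<gamma> * f p + ereal ((norm (x - p))\<^sup>2 / 2)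
             \<le> ereal \<gamma> * f y + ereal ((norm (x - y))\<^sup>2 / 2)"
  shows "(1 / \<gamma>) *\<^sub>R (x - p) \<in> subdifferential H f p"
proof (rule subdifferentialI)
  have sub: "subspace H"
    using H by (simp add: hilbert_carrier_def)
  then show "(1 / \<gamma>) *\<^sub>R (x - p) \<in> H"
    using x p by (simp add: subspace_diff subspace_scale)
  obtain y0 where y0: "y0 \<in> H" "f y0 \<noteq> \<infinity>"
    using f by (auto simp: Gamma0_def)
  have "f p \<noteq> \<infinity>"
    using p(2)[OF y0(1)] y0(2) \<open>\<gamma> > 0\<close> by (cases "f y0") auto
  then obtain c where c: "f p = ereal c"
    using Gamma0_real_of_ereal[OF f p(1)] by blast
  fix y assume y: "y \<in> H"
  show "ereal (inner (y - p) ((1 / \<gamma>) *\<^sub>R (x - p))) + f p \<le> f y"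
  proof (cases "f y = \<infinity>")
    case False
    then obtain e where e: "f y = ereal e"
      using Gamma0_real_of_ereal[OF f y] by blast
    have key: "\<gamma> * (c - e) + inner (x - p) (y - p) \<le> u * ((norm (y - p))\<^sup>2 / 2)" if u: "0 < u" "u < 1" for u
    proof -
      let ?w = "(1 - u) *\<^sub>R p + u *\<^sub>R y"
      let ?q = "(norm (x - ?w))\<^sup>2 / 2"
      have "?w \<in> H"
        using sub p y by (simp add: subspace_add subspace_scale)
      moreover have "f ?w \<le> ereal ((1 - u) * c + u * e)"
        using u by (intro Gamma0_convex[OF f p(1) y]) (auto simp: c e)
      then have "ereal \<gamma> * f ?w + ereal ?q \<le> ereal (\<gamma> * ((1 - u) * c + u * e) + ?q)"
        using \<open>\<gamma> > 0\<close> by (subst prox_objective_le_iff) auto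
      ultimately have "ereal \<gamma> * f p + ereal ((norm (x - p))\<^sup>2 / 2) \<le> ereal (\<gamma> * ((1 - u) * c + u * e) + ?q)"
        using p(2) order.trans by blast
      then have "u * (\<gamma> * (c - e) + inner (x - p) (y - p)) \<le> u * (u * ((norm (y - p))\<^sup>2 / 2))"
        unfolding c norm_diff_segment_sq by (simp add: field_simps power2_eq_square[of u])
      then show ?thesis
        using u by simp
    qed
    have "\<gamma> * (c - e) + inner (x - p) (y - p) \<le> 0"
    proof (rule tendsto_lowerbound)
      show "((\<lambda>u. u * ((norm (y - p))\<^sup>2 / 2)) \<longlongrightarrow> 0) (at_right 0)"
        by (auto intro!: tendsto_eq_intros)
      show "\<forall>\<^sub>F u in at_right 0. \<gamma> * (c - e) + inner (x - p) (y - p) \<le> u * ((norm (y - p))\<^sup>2 / 2)"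
        using key by (auto simp: eventually_at_right_field intro!: exI[of _ 1])
    qed simp
    then have "inner (x - p) (y - p) / \<gamma> + c \<le> e"
      using \<open>\<gamma> > 0\<close> by (simp add: field_simps)
    then show ?thesis
      by (simp add: c e inner_commute)
  qed simp
qed

text \<open>The direct method, with nested sublevel sets just above the infimum in place of a weakly
  convergent minimizing sequence. The quadratic term dominates the at most linear decrease of
  \<open>f\<close>, which makes the infimum finite and the sublevel sets bounded.\<close>

lemma prox_minimizer_exists:
  assumes f: "f \<in> Gamma0 H" and H: "hilbert_carrier H" and "\<gamma> > 0" and x: "x \<in> H"
  obtains p where "p \<in> H"
      "\<And>y. y \<in> H \<Longrightarrow> ereal \<gamma> * f p + ereal ((norm (x - p))\<^sup>2 / 2)
             \<le> ereal \<gamma> * f y + ereal ((norm (x - y))\<^sup>2 / 2)"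
proof -
  have sub: "subspace H" and compl: "complete H"
    using H by (auto simp: hilbert_carrier_def)
  obtain x0 c B where low: "x0 \<in> H" "B \<ge> 0" "\<And>y. y \<in> H \<Longrightarrow> ereal (c - B * norm (y - x0)) \<le> f y"
    using Gamma0_lower_bound[OF f H] by metis
  define \<phi> where "\<phi> y = ereal \<gamma> * f y + ereal ((norm (x - y))\<^sup>2 / 2)" for y
  \<comment> \<open>The real numbers above some value of \<open>\<phi>\<close>; their infimum is
    that of \<open>\<phi>\<close>, obtained as a real number.\<close>
  define V where "V = {e. \<exists>y\<in>H. \<phi> y \<le> ereal e}"
  define A where "A = \<gamma> * (c - B * norm (x - x0))"
  have quad: "A - \<gamma> * B * norm (x - y) + (norm (x - y))\<^sup>2 / 2 \<le> e"
    if "y \<in> H" "\<phi> y \<le> ereal e" for y e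
  proof -
    have "ereal (c - B * norm (y - x0)) \<le> ereal ((e - (norm (x - y))\<^sup>2 / 2) / \<gamma>)"
      using low(3)[OF that(1)] that(2) unfolding \<phi>_def prox_objective_le_iff[OF \<open>\<gamma> > 0\<close>]
      by (rule order.trans)
    then have "\<gamma> * (c - B * norm (y - x0)) + (norm (x - y))\<^sup>2 / 2 \<le> e"
      using \<open>\<gamma> > 0\<close> by (simp add: field_simps)
    moreover have "norm (y - x0) \<le> norm (x - y) + norm (x - x0)"
      using norm_triangle_ineq4[of "x - x0" "x - y"] by simp
    then have "\<gamma> * (B * norm (y - x0)) \<le> \<gamma> * (B * (norm (x - y) + norm (x - x0)))"
      using \<open>\<gamma> > 0\<close> \<open>B \<ge> 0\<close> by (intro mult_left_mono) auto
    ultimately show ?thesis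
      by (simp add: A_def algebra_simps)
  qed
  have "bdd_below V"
  proof (rule bdd_belowI)
    fix e assume "e \<in> V"
    then obtain y where "y \<in> H" "\<phi> y \<le> ereal e"
      by (auto simp: V_def)
    \<comment> \<open>Completing the square in \<open>quad\<close>.\<close>
    moreover have "0 \<le> (norm (x - y) - \<gamma> * B)\<^sup>2"
      by simp
    ultimately show "A - (\<gamma> * B)\<^sup>2 / 2 \<le> e"
      using quad[of y e] by (simp add: power2_eq_square algebra_simps)
  qed
  obtain y0 where y0: "y0 \<in> H" "f y0 \<noteq> \<infinity>"
    using f by (auto simp: Gamma0_def)
  have phi_real: "\<exists>e. \<phi> y = ereal e" if "y \<in> H" "f y \<noteq> \<infinity>" for y
    unfolding \<phi>_def by (subst Gamma0_real_of_ereal[OF f that]) simp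
  then have "V \<noteq> {}"
    using y0 phi_real[OF y0] unfolding V_def by force
  define M where "M = Inf V"
  define C where "C = \<bar>M + 1 - A\<bar>"
  have "0 \<le> C" "M + 1 - A \<le> C"
    by (simp_all add: C_def)
  define S where "S n = {y \<in> H. \<phi> y \<le> ereal (M + 1 / real (Suc n))}" for n
  have S_iff: "y \<in> S n \<longleftrightarrow> y \<in> H \<and> f y \<le> ereal ((M + 1 / real (Suc n) - (norm (x - y))\<^sup>2 / 2) / \<gamma>)" for y n
    by (simp only: S_def \<phi>_def mem_Collect_eq prox_objective_le_iff[OF \<open>\<gamma> > 0\<close>])
  have "(\<Inter>n. S n) \<noteq> {}"
  proof (rule nested_closed_convex_Inter_nonempty[OF compl])
    show "S n \<subseteq> H" for n
      by (auto simp: S_def)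
    show "closed (S n)" for n
      unfolding closed_sequential_limits
    proof (intro allI impI, elim conjE)
      fix y w assume y: "\<forall>k. y k \<in> S n" "y \<longlonglongrightarrow> w"
      then have "w \<in> H"
        using complete_imp_closed[OF compl] by (auto simp: S_iff intro: closed_sequentially)
      moreover have "f w \<le> ereal ((M + 1 / real (Suc n) - (norm (x - w))\<^sup>2 / 2) / \<gamma>)"
      proof (rule Gamma0_seq_closed[OF f \<open>w \<in> H\<close> _ y(2)])
        show "(\<lambda>k. (M + 1 / real (Suc n) - (norm (x - y k))\<^sup>2 / 2) / \<gamma>)
            \<longlonglongrightarrow> (M + 1 / real (Suc n) - (norm (x - w))\<^sup>2 / 2) / \<gamma>"
          using \<open>\<gamma> > 0\<close> by (intro tendsto_intros y(2)) simp_all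
      qed (use y(1) S_iff in blast)+
      ultimately show "w \<in> S n"
        by (simp add: S_iff)
    qed
    show "convex (S n)" for n
    proof (rule convexI)
      fix y w :: 'a and u1 u :: real
      assume yw: "y \<in> S n" "w \<in> S n" and u: "0 \<le> u1" "0 \<le> u" "u1 + u = 1"
      let ?e = "M + 1 / real (Suc n)"
      let ?v = "(1 - u) *\<^sub>R y + u *\<^sub>R w"
      have "?v \<in> H"
        using sub yw by (simp add: S_iff subspace_add subspace_scale)
      moreover have "f ?v \<le> ereal ((1 - u) * ((?e - (norm (x - y))\<^sup>2 / 2) / \<gamma>) + u * ((?e - (norm (x - w))\<^sup>2 / 2) / \<gamma>))"
        using yw u unfolding S_iff by (intro Gamma0_convex[OF f]) auto
      moreover have "(norm (x - ?v))\<^sup>2 = (1 - u) * (norm (x - y))\<^sup>2 + u * (norm (x - w))\<^sup>2 - u * (1 - u) * (norm (w - y))\<^sup>2"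
        unfolding power2_norm_eq_inner
        by (simp add: inner_add_left inner_add_right inner_diff_left inner_diff_right inner_commute
            algebra_simps power2_eq_square)
      then have "(norm (x - ?v))\<^sup>2 \<le> (1 - u) * (norm (x - y))\<^sup>2 + u * (norm (x - w))\<^sup>2"
        using u by simp
      then have "(?e - ((1 - u) * (norm (x - y))\<^sup>2 + u * (norm (x - w))\<^sup>2) / 2) / \<gamma> \<le> (?e - (norm (x - ?v))\<^sup>2 / 2) / \<gamma>"
        using \<open>\<gamma> > 0\<close> by (intro divide_right_mono) auto
      moreover have "(1 - u) * ((e - Y / 2) / \<gamma>) + u * ((e - W / 2) / \<gamma>) = (e - ((1 - u) * Y + u * W) / 2) / \<gamma>" for e Y W
        using \<open>\<gamma> > 0\<close> by (simp add: field_simps)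
      ultimately have "f ?v \<le> ereal ((?e - ((1 - u) * (norm (x - y))\<^sup>2 + u * (norm (x - w))\<^sup>2) / 2) / \<gamma>)"
        and "(?e - ((1 - u) * (norm (x - y))\<^sup>2 + u * (norm (x - w))\<^sup>2) / 2) / \<gamma> \<le> (?e - (norm (x - ?v))\<^sup>2 / 2) / \<gamma>"
        by (simp_all only:)
      with \<open>?v \<in> H\<close> have "?v \<in> S n"
        unfolding S_iff using order.trans ereal_less_eq(3) by blast
      then show "u1 *\<^sub>R y + u *\<^sub>R w \<in> S n"
        using u by (simp add: eq_diff_eq[symmetric])
    qed
    show "S n \<noteq> {}" for n
    proof -
      obtain e y where "y \<in> H" "\<phi> y \<le> ereal e" "e < M + 1 / real (Suc n)"
        using cInf_lessD[OF \<open>V \<noteq> {}\<close>, of "M + 1 / real (Suc n)"] by (auto simp: M_def V_def)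
      moreover from this have "\<phi> y \<le> ereal (M + 1 / real (Suc n))"
        using order.trans[of "\<phi> y" "ereal e"] by simp
      ultimately show ?thesis
        unfolding S_def by blast
    qed
    show "decseq S"
    proof (unfold decseq_def, intro allI impI subsetI)
      fix n k y assume "n \<le> k" "y \<in> S k"
      moreover from this have "ereal (M + 1 / real (Suc k)) \<le> ereal (M + 1 / real (Suc n))"
        by (simp add: frac_le)
      ultimately show "y \<in> S n"
        unfolding S_def using order.trans by blast
    qed
    show "norm y \<le> norm x + (2 * (\<gamma> * B) + 2 * C + 1)" if "y \<in> S n" for n y
    proof -
      have "y \<in> H" "\<phi> y \<le> ereal (M + 1 / real (Suc n))"
        using that by (auto simp: S_def)
      define G where "G = \<gamma> * B"
      from \<open>y \<in> H\<close> \<open>\<phi> y \<le> _\<close> have q: "A - G * norm (x - y) + (norm (x - y))\<^sup>2 / 2 \<le> M + 1 / real (Suc n)"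
        unfolding G_def by (rule quad)
      have gB: "0 \<le> G"
        using \<open>\<gamma> > 0\<close> \<open>B \<ge> 0\<close> by (simp add: G_def)
      define h where "h = 1 / real (Suc n)"
      have "h \<le> 1"
        by (simp add: h_def)
      then have q2: "(norm (x - y))\<^sup>2 - 2 * G * norm (x - y) \<le> 2 * C"
        using q[folded h_def] \<open>M + 1 - A \<le> C\<close> by simp
      \<comment> \<open>A larger distance \<open>h\<close> would be at least 1 with
        \<open>h - 2 * G > 2 * C + 1\<close>, so \<open>h * (h - 2 * G)\<close> would exceed
        \<open>2 * C\<close>, against \<open>q2\<close>.\<close>
      have "norm (x - y) \<le> 2 * G + 2 * C + 1"
      proof (rule ccontr)
        assume "\<not> ?thesis"
        then have big: "norm (x - y) - 2 * G > 2 * C + 1" "norm (x - y) \<ge> 1"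
          using gB \<open>0 \<le> C\<close> by linarith+
        then have "(norm (x - y) - 2 * G) * 1 \<le> (norm (x - y) - 2 * G) * norm (x - y)"
          using \<open>0 \<le> C\<close> by (intro mult_left_mono) auto
        then show False
          using q2 big by (simp add: power2_eq_square algebra_simps)
      qed
      then show ?thesis
        using norm_triangle_ineq4[of x "x - y"] by (simp add: G_def)
    qed
  qed
  then obtain p where p: "\<And>n. p \<in> S n"
    by auto
  have "p \<in> H"
    using p by (auto simp: S_def)
  have "f p \<le> ereal ((M - (norm (x - p))\<^sup>2 / 2) / \<gamma>)"
  proof (rule Gamma0_seq_closed[OF f \<open>p \<in> H\<close>, of "\<lambda>_. p" "\<lambda>n. (M + 1 / real (Suc n) - (norm (x - p))\<^sup>2 / 2) / \<gamma>"])
    have "(\<lambda>n. (M + 1 / real (Suc n) - (norm (x - p))\<^sup>2 / 2) / \<gamma>) \<longlonglongrightarrow> (M + 0 - (norm (x - p))\<^sup>2 / 2) / \<gamma>"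
      using \<open>\<gamma> > 0\<close> by (intro tendsto_intros LIMSEQ_Suc[OF lim_1_over_n]) auto
    then show "(\<lambda>n. (M + 1 / real (Suc n) - (norm (x - p))\<^sup>2 / 2) / \<gamma>) \<longlonglongrightarrow> (M - (norm (x - p))\<^sup>2 / 2) / \<gamma>"
      by simp
    show "f p \<le> ereal ((M + 1 / real (Suc n) - (norm (x - p))\<^sup>2 / 2) / \<gamma>)" for n
      using p S_iff by blast
  qed (use \<open>p \<in> H\<close> in auto)
  then have pM: "\<phi> p \<le> ereal M"
    unfolding \<phi>_def prox_objective_le_iff[OF \<open>\<gamma> > 0\<close>] .
  have "\<phi> p \<le> \<phi> y" if "y \<in> H" for y
  proof (cases "f y = \<infinity>")
    case True
    then show ?thesis
      using \<open>\<gamma> > 0\<close> by (simp add: \<phi>_def)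
  next
    case False
    then obtain e where "\<phi> y = ereal e"
      using phi_real \<open>y \<in> H\<close> by blast
    moreover from this have "M \<le> e"
      using \<open>bdd_below V\<close> \<open>y \<in> H\<close> unfolding M_def V_def by (intro cInf_lower) force+
    ultimately show ?thesis
      using pM order.trans[of "\<phi> p" "ereal M" "ereal e"] by simp
  qed
  then show ?thesis
    using that \<open>p \<in> H\<close> unfolding \<phi>_def by blast
qed

text \<open>Makes the definite description in \<open>prox\<close> meaningful. Uniqueness comes from
  monotonicity: the subgradients attached to two minimizers differ by a negative multiple of the
  difference of the minimizers.\<close>

lemma prox_subdifferential:
  assumes f: "f \<in> Gamma0 H" and H: "hilbert_carrier H" and "\<gamma> > 0" and x: "x \<in> H"
  defines "p \<equiv> prox H (\<lambda>y. ereal \<gamma> * f y) x"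
  shows "p \<in> H" "(1 / \<gamma>) *\<^sub>R (x - p) \<in> subdifferential H f p"
proof -
  let ?min = "is_arg_min (\<lambda>y. ereal \<gamma> * f y + ereal ((norm (x - y))\<^sup>2 / 2)) (\<lambda>y. y \<in> H)"
  have sd: "(1 / \<gamma>) *\<^sub>R (x - q) \<in> subdifferential H f q" if "?min q" for q
    using that by (intro prox_minimizer_subdifferential[OF f H \<open>\<gamma> > 0\<close> x]) (auto simp: is_arg_min_linorder)
  have "?min p"
    unfolding p_def prox_def
  proof (rule theI')
    obtain q where "?min q"
      using prox_minimizer_exists[OF f H \<open>\<gamma> > 0\<close> x] unfolding is_arg_min_linorder by metis
    moreover have "q' = q" if "?min q'" for q'
    proof -
      have "0 \<le> inner (q' - q) ((1 / \<gamma>) *\<^sub>R (x - q') - (1 / \<gamma>) *\<^sub>R (x - q))"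
        using subdifferential_monotone[OF f _ _ sd[OF that] sd[OF \<open>?min q\<close>]] that \<open>?min q\<close>
        by (simp add: is_arg_min_def)
      also have "\<dots> = - (1 / \<gamma>) * (norm (q' - q))\<^sup>2"
        unfolding power2_norm_eq_inner by (simp add: algebra_simps inner_diff_left inner_diff_right inner_commute)
      finally have "(norm (q' - q))\<^sup>2 \<le> 0"
        using \<open>\<gamma> > 0\<close> by (simp add: divide_le_0_iff)
      then show ?thesis
        by simp
    qed
    ultimately show "\<exists>!q. ?min q"
      by blast
  qed
  then show "p \<in> H" "(1 / \<gamma>) *\<^sub>R (x - p) \<in> subdifferential H f p"
    using sd by (auto simp: is_arg_min_def)
qed

text \<open>Surjectivity of the identity plus the subdifferential, from the proximal point with
  parameter 1. It supplies Riesz representers, the inversion of subdifferentials by conjugation, and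
  maximal monotonicity.\<close>

lemma subdifferential_resolvent:
  assumes "f \<in> Gamma0 H" "hilbert_carrier H" "x \<in> H"
  obtains p where "p \<in> H" "x - p \<in> subdifferential H f p"
  using prox_subdifferential[OF assms(1,2) zero_less_one assms(3)] by auto

section \<open>Bounded linear operators and adjoints\<close>

lemma bounded_linear_between_diff:
  assumes "bounded_linear_between H G L" "subspace H" "x \<in> H" "y \<in> H"
  shows "L (x - y) = L x - L y"
proof -
  have "L (x + (-1) *\<^sub>R y) = L x + L ((-1) *\<^sub>R y)" "L ((-1) *\<^sub>R y) = (-1) *\<^sub>R L y"
    using assms subspace_scale[OF assms(2,4), of "-1"] unfolding bounded_linear_between_def by blast+
  then show ?thesis
    by simp
qed

text \<open>The minus sign is chosen because the minimizer of half the squared norm minus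
  \<open>inner (L x) w\<close> is the Riesz representer of the functional
  \<open>inner (L x) w\<close>.\<close>

lemma Gamma0_linear_functional:
  assumes H: "hilbert_carrier H" and L: "bounded_linear_between H G L"
  shows "(\<lambda>x. ereal (- inner (L x) w)) \<in> Gamma0 H"
proof -
  have sub: "subspace H"
    using H by (simp add: hilbert_carrier_def)
  obtain B where B: "\<And>x. x \<in> H \<Longrightarrow> norm (L x) \<le> B * norm x"
    using L unfolding bounded_linear_between_def by blast
  have lim: "((\<lambda>y. - inner (L y) w) \<longlongrightarrow> - inner (L x) w) (at x within H)" if "x \<in> H" for x
  proof -
    have "((\<lambda>y. L y - L x) \<longlongrightarrow> 0) (at x within H)"
    proof (rule Lim_null_comparison)
      show "((\<lambda>y. B * norm (y - x)) \<longlongrightarrow> 0) (at x within H)"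
        by (auto intro!: tendsto_eq_intros)
      show "\<forall>\<^sub>F y in at x within H. norm (L y - L x) \<le> B * norm (y - x)"
        unfolding eventually_at using B[OF subspace_diff[OF sub _ that]] bounded_linear_between_diff[OF L sub _ that]
        by (auto intro!: exI[of _ 1])
    qed
    then have "(L \<longlongrightarrow> L x) (at x within H)"
      by (simp add: LIM_zero_iff)
    then show ?thesis
      by (intro tendsto_intros)
  qed
  have "ereal (- inner (L x) w) \<le> Liminf (at x within H) (\<lambda>x. ereal (- inner (L x) w))" if "x \<in> H" for x
    unfolding le_Liminf_iff using lim[OF that] by (auto intro: order_tendstoD(1) tendsto_ereal)
  moreover have "- inner (L ((1 - t) *\<^sub>R x + t *\<^sub>R y)) w = (1 - t) * - inner (L x) w + t * - inner (L y) w"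
    if "x \<in> H" "y \<in> H" for x y t
  proof -
    have "L ((1 - t) *\<^sub>R x + t *\<^sub>R y) = (1 - t) *\<^sub>R L x + t *\<^sub>R L y"
      using L that sub by (simp add: bounded_linear_between_def subspace_scale)
    then show ?thesis
      by (simp add: inner_add_left)
  qed
  ultimately show ?thesis
    using subspace_0[OF sub] by (auto simp: Gamma0_def)
qed

text \<open>The Riesz representer of \<open>x \<mapsto> \<langle>L x, y\<rangle>\<close> is the proximal point of \<open>0\<close> for the negative of this
  functional.\<close>

lemma adjoint_on:
  assumes H: "hilbert_carrier H" and L: "bounded_linear_between H G L"
  shows "adjoint_on H L y \<in> H" "\<And>x. x \<in> H \<Longrightarrow> inner (L x) y = inner x (adjoint_on H L y)"
proof -
  have sub: "subspace H"
    using H by (simp add: hilbert_carrier_def)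
  let ?P = "\<lambda>w. w \<in> H \<and> (\<forall>x\<in>H. inner (L x) y = inner x w)"
  have "?P (adjoint_on H L y)"
    unfolding adjoint_on_def
  proof (rule theI')
    let ?f = "\<lambda>x. ereal (- inner (L x) y)"
    obtain w where w: "w \<in> H" "0 - w \<in> subdifferential H ?f w"
      using subdifferential_resolvent[OF Gamma0_linear_functional[OF H L] H subspace_0[OF sub]] by blast
    have le: "inner (L x) y \<le> inner x w" if "x \<in> H" for x
    proof -
      have "w + x \<in> H"
        using sub w that by (simp add: subspace_add)
      then have "inner (w + x - w) (0 - w) - inner (L w) y \<le> - inner (L (w + x)) y"
        using w(2) by (auto simp: subdifferential_def)
      moreover have "L (w + x) = L w + L x"
        using L w that by (simp add: bounded_linear_between_def)
      ultimately show ?thesis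
        by (simp add: inner_add_left)
    qed
    have "inner (L x) y = inner x w" if "x \<in> H" for x
    proof (rule antisym)
      have "L (- x) = - L x" "- x \<in> H"
        using bounded_linear_between_diff[OF L sub subspace_0[OF sub] that]
          bounded_linear_between_diff[OF L sub subspace_0[OF sub] subspace_0[OF sub]]
          subspace_neg[OF sub that] by auto
      \<comment> \<open>Both sides are odd in \<open>x\<close>, so \<open>le\<close> at
        \<open>- x\<close> is the reverse inequality.\<close>
      then show "inner x w \<le> inner (L x) y"
        using le[of "- x"] by simp
    qed (rule le[OF that])
    moreover have "w' = w" if "?P w'" for w'
    proof -
      have "inner (w' - w) w' = inner (w' - w) w"
        using calculation that subspace_diff[OF sub _ w(1)] by metis
      then have "inner (w' - w) (w' - w) = 0"
        by (simp add: inner_diff_right)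
      then show ?thesis
        by simp
    qed
    ultimately show "\<exists>!w. ?P w"
      using w by blast
  qed
  then show "adjoint_on H L y \<in> H" "\<And>x. x \<in> H \<Longrightarrow> inner (L x) y = inner x (adjoint_on H L y)"
    by auto
qed

section \<open>Conjugates and inversion of subdifferentials\<close>

lemma conjugate_eq:
  assumes "f \<in> Gamma0 H" "x \<in> H" "u \<in> subdifferential H f x" "f x = ereal c"
  shows "conjugate H f u = ereal (inner x u - c)"
proof (rule antisym)
  show "conjugate H f u \<le> ereal (inner x u - c)"
    unfolding conjugate_def
  proof (rule SUP_least)
    fix y assume "y \<in> H"
    then have "ereal (inner (y - x) u) + f x \<le> f y"
      using assms by (simp add: subdifferential_def)
    then show "ereal (inner y u) - f y \<le> ereal (inner x u - c)"
      using assms(4) by (cases "f y") (auto simp: inner_diff_left)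
  qed
  show "ereal (inner x u - c) \<le> conjugate H f u"
    unfolding conjugate_def using assms by (intro SUP_upper2[of x]) auto
qed

text \<open>The conjugate at any \<open>w\<close> is at least \<open>inner x w - f x\<close>, with
  equality at \<open>w = u\<close> by \<open>conjugate_eq\<close>; subtracting the two gives the
  subgradient inequality.\<close>

lemma subdifferential_conjugateI:
  assumes "f \<in> Gamma0 H" "x \<in> H" "u \<in> subdifferential H f x"
  shows "x \<in> subdifferential H (conjugate H f) u"
proof (rule subdifferentialI)
  obtain c where c: "f x = ereal c"
    using subdifferential_finite[OF assms] .
  fix w assume "w \<in> H"
  have "ereal (inner x w) - f x \<le> conjugate H f w"
    unfolding conjugate_def using assms(2) by (rule SUP_upper)
  then show "ereal (inner (w - u) x) + conjugate H f u \<le> conjugate H f w"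
    by (simp add: conjugate_eq[OF assms c] c inner_diff_right inner_commute[of _ x])
qed (rule assms(2))

text \<open>The converse holds by comparing \<open>u\<close> with the proximal point \<open>p\<close> of \<open>u + v\<close>: both \<open>(v, u)\<close> and
  \<open>(u + v - p, p)\<close> lie in the graph of the monotone operator \<open>\<partial>f\<^sup>*\<close>.\<close>

lemma subdifferential_conjugateD:
  assumes f: "f \<in> Gamma0 H" and H: "hilbert_carrier H" and "v \<in> H"
    and u: "u \<in> subdifferential H (conjugate H f) v"
  shows "v \<in> subdifferential H f u"
proof -
  have sub: "subspace H"
    using H by (simp add: hilbert_carrier_def)
  have "u \<in> H"
    using u by (simp add: subdifferential_def)
  then have "u + v \<in> H"
    using sub \<open>v \<in> H\<close> by (simp add: subspace_add)
  then obtain p where p: "p \<in> H" "u + v - p \<in> subdifferential H f p"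
    using subdifferential_resolvent[OF f H] by blast
  let ?w = "u + v - p"
  have "?w \<in> H"
    using p(2) by (simp add: subdifferential_def)
  obtain c where c: "f p = ereal c"
    using subdifferential_finite[OF f p] .
  have "ereal (inner (?w - v) u) + conjugate H f v \<le> ereal (inner p ?w - c)"
    using u \<open>?w \<in> H\<close> conjugate_eq[OF f p c] by (auto simp: subdifferential_def)
  moreover have "ereal (inner (v - ?w) p) + ereal (inner p ?w - c) \<le> conjugate H f v"
    using subdifferential_conjugateI[OF f p] \<open>v \<in> H\<close> conjugate_eq[OF f p c]
    by (auto simp: subdifferential_def)
  \<comment> \<open>Either infinite value of \<open>conjugate H f v\<close> contradicts one of the
    two inequalities, so it cancels. Since \<open>?w - v = u - p\<close>, the left-hand side is the
    squared norm of \<open>u - p\<close>.\<close>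
  ultimately have "inner (?w - v) u + inner (v - ?w) p \<le> 0"
    by (cases "conjugate H f v") auto
  then have "inner (u - p) (u - p) \<le> 0"
    by (simp add: algebra_simps inner_diff_left inner_diff_right inner_commute)
  then have "u = p"
    by (metis eq_iff_diff_eq_0 inner_gt_zero_iff not_le)
  then show ?thesis
    using p(2) by simp
qed

section \<open>The Haugazeau step\<close>

text \<open>The closed form of the projection of \<open>p0\<close> onto the intersection of the
  half-spaces \<open>{c. inner (c - p) (p0 - p) \<le> 0}\<close> and
  \<open>{c. inner (c - ph) (p - ph) \<le> 0}\<close>. A relation rather than a function, since one
  combination of signs is left unspecified.\<close>

definition haugazeau_step :: "'a::real_inner \<Rightarrow> 'a \<Rightarrow> 'a \<Rightarrow> 'a \<Rightarrow> bool" where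
  "haugazeau_step p0 p ph p' \<longleftrightarrow>
    (let chi = inner (p0 - p) (p - ph); \<omega> = (norm (p0 - p))\<^sup>2; \<nu> = (norm (p - ph))\<^sup>2; \<rho> = \<omega> * \<nu> - chi\<^sup>2 in
     (\<rho> = 0 \<longrightarrow> chi \<ge> 0 \<longrightarrow> p' = ph) \<and>
     (\<rho> > 0 \<longrightarrow> chi * \<nu> \<ge> \<rho> \<longrightarrow> p' = p0 + (1 + chi / \<nu>) *\<^sub>R (ph - p)) \<and>
     (\<rho> > 0 \<longrightarrow> chi * \<nu> < \<rho> \<longrightarrow> p' = p + (\<nu> / \<rho>) *\<^sub>R (chi *\<^sub>R (p0 - p) + \<omega> *\<^sub>R (ph - p))))"

text \<open>The case \<open>\<rho> = 0\<close>, \<open>chi < 0\<close>, for which the step is unspecified, does not arise: it would make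
  the two half-spaces disjoint, but \<open>z\<close> lies in both.\<close>

lemma haugazeau_step_halfspaces:
  fixes p0 p ph p' z :: "'a::real_inner"
  assumes step: "haugazeau_step p0 p ph p'"
    and z: "inner (z - p) (p0 - p) \<le> 0" "inner (z - ph) (p - ph) \<le> 0"
  shows "inner (p' - p) (p0 - p) \<le> 0" "inner (p' - p) (p - ph) \<le> - (norm (p - ph))\<^sup>2"
    "inner (z - p') (p0 - p') \<le> 0"
    "\<And>S. subspace S \<Longrightarrow> p0 \<in> S \<Longrightarrow> p \<in> S \<Longrightarrow> ph \<in> S \<Longrightarrow> p' \<in> S"
proof -
  define u w d e where "u = p0 - p" and "w = p - ph" and "d = z - p" and "e = p' - p"
  define chi \<omega> \<nu> where "chi = inner u w" and "\<omega> = inner u u" and "\<nu> = inner w w"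
  define \<rho> where "\<rho> = \<omega> * \<nu> - chi\<^sup>2"
  have du: "inner d u \<le> 0" and dw: "inner d w \<le> - \<nu>"
    using z by (simp_all add: d_def u_def w_def \<nu>_def inner_diff_left inner_diff_right inner_commute)
  have shift: "p0 - p = u" "p - ph = w" "ph - p = - w"
    by (simp_all add: u_def w_def)
  have step': "\<rho> = 0 \<Longrightarrow> chi \<ge> 0 \<Longrightarrow> e = - w"
    "\<rho> > 0 \<Longrightarrow> chi * \<nu> \<ge> \<rho> \<Longrightarrow> e = u - (1 + chi / \<nu>) *\<^sub>R w"
    "\<rho> > 0 \<Longrightarrow> chi * \<nu> < \<rho> \<Longrightarrow> e = (\<nu> / \<rho>) *\<^sub>R (chi *\<^sub>R u - \<omega> *\<^sub>R w)"
    using step unfolding haugazeau_step_def Let_def power2_norm_eq_inner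
    by (simp_all add: shift chi_def[symmetric] \<omega>_def[symmetric] \<nu>_def[symmetric] \<rho>_def[symmetric])
      (simp_all add: e_def u_def w_def algebra_simps)
  have "\<rho> \<ge> 0"
    using Cauchy_Schwarz_ineq[of u w] by (simp add: \<rho>_def chi_def \<omega>_def \<nu>_def)
  have "\<nu> \<ge> 0"
    by (simp add: \<nu>_def)
  \<comment> \<open>Relative to \<open>p\<close>: \<open>e\<close> lies in both half-spaces,
    \<open>d\<close> lies in the half-space at \<open>e\<close> with normal \<open>u - e\<close>,
    and \<open>e\<close> is a combination of \<open>u\<close> and \<open>w\<close>, which keeps the
    iterates in the carrier.\<close>
  have goals: "inner e u \<le> 0 \<and> inner e w \<le> - \<nu> \<and> inner (d - e) (u - e) \<le> 0
    \<and> (\<exists>\<alpha> \<beta>. e = \<alpha> *\<^sub>R u + \<beta> *\<^sub>R w)"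
  proof (cases "\<rho> = 0")
    case True
    have dep: "chi \<ge> 0 \<and> inner d u \<le> 0 \<and> inner (d + w) (u + w) \<le> 0"
    proof (cases "w = 0")
      case True
      then show ?thesis
        using du by (simp add: chi_def)
    next
      case False
      then have "\<nu> > 0"
        by (simp add: \<nu>_def)
      \<comment> \<open>\<open>\<rho>\<close> is the Gram determinant of \<open>u\<close> and
        \<open>w\<close>. When it vanishes, \<open>u\<close> is a multiple of \<open>w\<close>, and
        pairing with \<open>d\<close> excludes a negative factor.\<close>
      have "inner (u - (chi / \<nu>) *\<^sub>R w) (u - (chi / \<nu>) *\<^sub>R w) = \<omega> - 2 * (chi / \<nu>) * chi + (chi / \<nu>)\<^sup>2 * \<nu>"
        by (simp add: \<omega>_def chi_def \<nu>_def inner_diff_left inner_diff_right inner_commute power2_eq_square)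
      also have "\<dots> = \<rho> / \<nu>"
        using \<open>\<nu> > 0\<close> by (simp add: \<rho>_def power2_eq_square field_simps)
      finally have "u = (chi / \<nu>) *\<^sub>R w"
        using True by simp
      then have ud: "inner h u = chi / \<nu> * inner h w" for h
        by (metis inner_scaleR_right)
      have "chi \<ge> 0"
      proof (rule ccontr)
        assume "\<not> chi \<ge> 0"
        then have "chi / \<nu> * inner d w > 0"
          using dw \<open>\<nu> > 0\<close> by (intro mult_neg_neg) (auto simp: divide_neg_pos)
        then show False
          using ud du by simp
      qed
      moreover have "inner (d + w) w \<le> 0"
        using dw by (simp add: inner_add_left \<nu>_def)
      moreover from calculation have "chi / \<nu> * inner (d + w) w \<le> 0"
        using \<open>\<nu> > 0\<close> by (intro mult_nonneg_nonpos) auto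
      then have "inner (d + w) u \<le> 0"
        by (simp add: ud)
      ultimately show ?thesis
        using du by (simp add: inner_add_right)
    qed
    then have "e = - w"
      using step'(1) True by simp
    moreover from this have "\<exists>\<alpha> \<beta>. e = \<alpha> *\<^sub>R u + \<beta> *\<^sub>R w"
      by (intro exI[of _ 0] exI[of _ "- 1"]) simp
    ultimately show ?thesis
      using dep by (simp add: chi_def \<nu>_def inner_commute)
  next
    case False
    then have "\<rho> > 0"
      using \<open>\<rho> \<ge> 0\<close> by simp
    then have "\<nu> > 0"
      using \<open>\<nu> \<ge> 0\<close> by (cases "\<nu> = 0") (auto simp: \<rho>_def)
    have uu: "inner u u = \<omega>" "inner w w = \<nu>" "inner u w = chi" "inner w u = chi"
      by (simp_all add: \<omega>_def \<nu>_def chi_def inner_commute)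
    show ?thesis
    proof (cases "chi * \<nu> \<ge> \<rho>")
      case True
      \<comment> \<open>Here \<open>e\<close> is on the boundary of the half-space with normal
        \<open>w\<close>, and \<open>u - e\<close> is a nonnegative multiple of that normal.\<close>
      then have e: "e = u - (1 + chi / \<nu>) *\<^sub>R w"
        using step'(2) \<open>\<rho> > 0\<close> by simp
      have "chi \<ge> 0"
        using True \<open>\<rho> > 0\<close> \<open>\<nu> > 0\<close> by (metis less_le_trans less_imp_le zero_less_mult_pos2)
      have ew: "inner e w = - \<nu>"
        using \<open>\<nu> > 0\<close> by (simp add: e inner_diff_left uu field_simps)
      moreover have "inner e u = (\<rho> - chi * \<nu>) / \<nu>"
        using \<open>\<nu> > 0\<close> by (simp add: e inner_diff_left uu \<rho>_def power2_eq_square field_simps)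
      moreover have "inner (d - e) (u - e) = (1 + chi / \<nu>) * (inner d w + \<nu>)"
        using ew by (simp add: e inner_diff_left uu)
      moreover have "\<dots> \<le> 0"
        using dw \<open>\<nu> > 0\<close> \<open>chi \<ge> 0\<close> by (intro mult_nonneg_nonpos) auto
      moreover have "\<exists>\<alpha> \<beta>. e = \<alpha> *\<^sub>R u + \<beta> *\<^sub>R w"
        by (intro exI[of _ 1] exI[of _ "- (1 + chi / \<nu>)"]) (simp add: e algebra_simps)
      ultimately show ?thesis
        using True \<open>\<nu> > 0\<close> by (simp add: divide_le_0_iff)
    next
      case False
      \<comment> \<open>Here \<open>e\<close> is on both boundaries, and \<open>u - e\<close> is a
        combination of both normals \<open>u\<close> and \<open>w\<close> with nonnegative
        coefficients; \<open>chi * \<nu> < \<rho>\<close> gives the sign of the first one.\<close>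
      then have e: "e = (\<nu> / \<rho>) *\<^sub>R (chi *\<^sub>R u - \<omega> *\<^sub>R w)"
        using step'(3) \<open>\<rho> > 0\<close> by simp
      have "inner e w = (\<nu> / \<rho>) * (- \<rho>)"
        by (simp add: e inner_diff_left uu \<rho>_def power2_eq_square)
      then have ew: "inner e w = - \<nu>"
        using \<open>\<rho> > 0\<close> by simp
      have eu: "inner e u = 0"
        by (simp add: e inner_diff_left uu)
      have ue: "u - e = (1 - \<nu> * chi / \<rho>) *\<^sub>R u + (\<nu> * \<omega> / \<rho>) *\<^sub>R w"
        by (simp add: e algebra_simps)
      have "inner (d - e) (u - e) = (1 - \<nu> * chi / \<rho>) * inner d u + (\<nu> * \<omega> / \<rho>) * (inner d w + \<nu>)"
        unfolding ue by (simp add: inner_diff_left inner_add_right ew eu algebra_simps)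
      moreover have "(1 - \<nu> * chi / \<rho>) * inner d u \<le> 0"
        using du False \<open>\<rho> > 0\<close> by (intro mult_nonneg_nonpos) (auto simp: field_simps)
      moreover have "(\<nu> * \<omega> / \<rho>) * (inner d w + \<nu>) \<le> 0"
        using dw \<open>\<rho> > 0\<close> \<open>\<nu> > 0\<close> by (intro mult_nonneg_nonpos) (auto simp: \<omega>_def)
      moreover have "\<exists>\<alpha> \<beta>. e = \<alpha> *\<^sub>R u + \<beta> *\<^sub>R w"
        by (intro exI[of _ "\<nu> / \<rho> * chi"] exI[of _ "- (\<nu> / \<rho> * \<omega>)"]) (simp add: e algebra_simps)
      ultimately show ?thesis
        by (simp add: ew eu)
    qed
  qed
  then show "inner (p' - p) (p0 - p) \<le> 0" "inner (p' - p) (p - ph) \<le> - (norm (p - ph))\<^sup>2"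
    by (simp_all add: e_def u_def w_def \<nu>_def power2_norm_eq_inner)
  show "inner (z - p') (p0 - p') \<le> 0"
    using goals by (simp add: d_def e_def u_def)
  fix S :: "'a set" assume S: "subspace S" "p0 \<in> S" "p \<in> S" "ph \<in> S"
  obtain \<alpha> \<beta> where "e = \<alpha> *\<^sub>R u + \<beta> *\<^sub>R w"
    using goals by blast
  then have "e \<in> S"
    using S by (simp add: u_def w_def subspace_add subspace_diff subspace_scale)
  then show "p' \<in> S"
    using S subspace_add[of S p e] by (simp add: e_def)
qed

text \<open>\<open>Gr\<close> is the graph of an operator whose zero set is \<open>Z\<close>, and \<open>ph n\<close> is the relaxed
  projection of \<open>p n\<close> onto the half-space \<open>{c. inner (c - q n) (w n) \<le> 0}\<close>, which contains \<open>Z\<close>.\<close>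

theorem haugazeau_monotone_converges:
  fixes p ph q w :: "nat \<Rightarrow> 'a::real_inner" and Gr :: "('a \<times> 'a) set"
  assumes X: "complete X" "subspace X"
    and mono: "\<And>y y' u u'. (y, y') \<in> Gr \<Longrightarrow> (u, u') \<in> Gr \<Longrightarrow> 0 \<le> inner (y - u) (y' - u')"
    and Gr: "Gr \<subseteq> X \<times> X"
    and Z: "Z = {c \<in> X. \<forall>y y'. (y, y') \<in> Gr \<longrightarrow> 0 \<le> inner (y - c) y'}"
    and init: "p 0 \<in> X" and qw: "\<And>n. p n \<in> X \<Longrightarrow> (q n, w n) \<in> Gr"
    and coercive: "0 < \<alpha>" "\<And>n. p n \<in> X \<Longrightarrow> \<alpha> * (norm (p n - q n))\<^sup>2 \<le> inner (p n - q n) (w n)"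
    and bounded: "\<And>n. p n \<in> X \<Longrightarrow> (norm (w n))\<^sup>2 \<le> \<beta> * inner (p n - q n) (w n)"
    and half: "\<And>n. ph n = p n - \<theta> n *\<^sub>R w n"
    and relax: "0 < \<epsilon>" "\<And>n. w n \<noteq> 0 \<Longrightarrow> lam n \<in> {\<epsilon>..1}"
      "\<And>n. p n \<in> X \<Longrightarrow> w n \<noteq> 0 \<Longrightarrow> \<theta> n = lam n * inner (p n - q n) (w n) / (norm (w n))\<^sup>2"
    and step: "\<And>n. haugazeau_step (p 0) (p n) (ph n) (p (Suc n))"
    and best: "pbar \<in> Z" "\<And>c. c \<in> Z \<Longrightarrow> norm (p 0 - pbar) \<le> norm (p 0 - c)"
  shows "p \<longlonglongrightarrow> pbar"
proof -
  define D where "D n = inner (p n - q n) (w n)" for n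
  have D0: "D n \<ge> 0" if "p n \<in> X" for n
    using coercive(2)[OF that] coercive(1) unfolding D_def
    by (meson mult_nonneg_nonneg less_imp_le order.trans zero_le_power2)
  \<comment> \<open>As \<open>lam n \<le> 1\<close>, the relaxed projection does not cross the
    boundary of the half-space of \<open>(q n, w n)\<close>, so the half-space through
    \<open>ph n\<close> with the same normal still contains \<open>Z\<close>.\<close>
  have relaxed: "inner (c - ph n) (p n - ph n) \<le> 0" if "p n \<in> X" "c \<in> Z" for c n
  proof (cases "w n = 0")
    case False
    have "\<theta> n \<ge> 0"
      using relax(2)[OF False] relax(3)[OF that(1) False] D0[OF that(1)] relax(1) by (simp add: D_def)
    have "\<theta> n * (norm (w n))\<^sup>2 = lam n * D n"
      using relax(3)[OF that(1) False] False by (simp add: D_def)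
    also have "\<dots> \<le> D n"
      using relax(2)[OF False] D0[OF that(1)] by (intro mult_left_le_one_le) (use relax(1) in auto)
    finally have "\<theta> n * (norm (w n))\<^sup>2 \<le> D n" .
    moreover have "0 \<le> inner (q n - c) (w n)"
      using that qw by (auto simp: Z)
    ultimately have "inner (c - p n) (w n) + \<theta> n * inner (w n) (w n) \<le> 0"
      by (simp add: D_def power2_norm_eq_inner inner_diff_left)
    then have "\<theta> n * (inner (c - p n) (w n) + \<theta> n * inner (w n) (w n)) \<le> 0"
      using \<open>\<theta> n \<ge> 0\<close> by (rule mult_nonneg_nonpos[rotated])
    then show ?thesis
      by (simp add: half inner_diff_left inner_add_left algebra_simps)
  qed (simp add: half)
  \<comment> \<open>The two properties go through the induction together: the graph facts require
    \<open>p n \<in> X\<close>, and even the membership of the next iterate relies on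
    \<open>pbar\<close> lying in both half-spaces.\<close>
  have invariant: "p n \<in> X \<and> (\<forall>c\<in>Z. inner (c - p n) (p 0 - p n) \<le> 0)" for n
  proof (induction n)
    case (Suc n)
    then have "ph n \<in> X"
      using X(2) qw[of n] Gr by (auto simp: half intro!: subspace_diff subspace_scale)
    then show ?case
      using haugazeau_step_halfspaces(3)[OF step _ relaxed] haugazeau_step_halfspaces(4)[OF step _ relaxed X(2) init]
        Suc best(1) by blast
  qed (simp add: init)
  then have pX: "p n \<in> X" and below: "c \<in> Z \<Longrightarrow> inner (c - p n) (p 0 - p n) \<le> 0" for n c
    by blast+
  note qw = qw[OF pX] and coercive = coercive(1) coercive(2)[OF pX] and bounded = bounded[OF pX]
    and relax = relax(1,2) relax(3)[OF pX]
    and D0 = D0[OF pX] and below_relaxed = relaxed[OF pX]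
  have qX: "q n \<in> X" for n
    using qw Gr by blast
  note halfspaces = haugazeau_step_halfspaces(1,2)[OF step below[OF best(1)] below_relaxed[OF best(1)]]
  have pythagoras: "(norm (a - b))\<^sup>2 + (norm (b - c))\<^sup>2 \<le> (norm (a - c))\<^sup>2" if "inner (c - b) (a - b) \<le> 0" for a b c :: 'a
    using that by (simp add: power2_norm_eq_inner inner_diff_left inner_diff_right inner_commute)
  define \<delta> where "\<delta> n = (norm (p 0 - p n))\<^sup>2" for n
  have incr: "\<delta> n + (norm (p n - p (Suc n)))\<^sup>2 \<le> \<delta> (Suc n)" for n
    unfolding \<delta>_def by (rule pythagoras[OF halfspaces(1)])
  have gap: "\<delta> n + (norm (p n - pbar))\<^sup>2 \<le> (norm (p 0 - pbar))\<^sup>2" for n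
    unfolding \<delta>_def by (rule pythagoras[OF below[OF best(1)]])
  have "incseq \<delta>"
    using incr by (intro incseq_SucI) (meson add_increasing2 order.trans order_refl zero_le_power2)
  moreover have "\<delta> n \<le> (norm (p 0 - pbar))\<^sup>2" for n
    using gap[of n] by (meson le_add_same_cancel1 order.trans zero_le_power2)
  ultimately obtain \<Delta> where \<Delta>: "\<delta> \<longlonglongrightarrow> \<Delta>" "\<And>n. \<delta> n \<le> \<Delta>"
    using incseq_convergent[of \<delta> "(norm (p 0 - pbar))\<^sup>2"] by blast
  have "(\<lambda>n. norm (p n - ph n)) \<longlonglongrightarrow> 0"
  proof (rule Lim_null_comparison)
    have "(\<lambda>n. sqrt (\<delta> (Suc n) - \<delta> n)) \<longlonglongrightarrow> sqrt (\<Delta> - \<Delta>)"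
      by (intro tendsto_intros LIMSEQ_Suc \<Delta>)
    then show "(\<lambda>n. sqrt (\<delta> (Suc n) - \<delta> n)) \<longlonglongrightarrow> 0"
      by simp
    \<comment> \<open>The next iterate lies in the half-space onto which \<open>ph n\<close>
      projects \<open>p n\<close>, so moving to it is at least as long as moving to
      \<open>ph n\<close>; \<open>incr\<close> bounds the length of that move.\<close>
    have "norm (p n - ph n) \<le> sqrt (\<delta> (Suc n) - \<delta> n)" for n
    proof -
      have "(norm (p n - ph n))\<^sup>2 \<le> inner (p n - p (Suc n)) (p n - ph n)"
        using halfspaces(2)[of n] by (simp add: inner_diff_left)
      also have "\<dots> \<le> norm (p n - p (Suc n)) * norm (p n - ph n)"
        by (rule norm_cauchy_schwarz)
      finally have "norm (p n - ph n) \<le> norm (p n - p (Suc n))"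
        by (cases "p n = ph n") (auto simp: power2_eq_square)
      also have "\<dots> \<le> sqrt (\<delta> (Suc n) - \<delta> n)"
        using incr[of n] by (intro real_le_rsqrt) simp
      finally show ?thesis .
    qed
    then show "\<forall>\<^sub>F n in sequentially. norm (norm (p n - ph n)) \<le> sqrt (\<delta> (Suc n) - \<delta> n)"
      by simp
  qed
  \<comment> \<open>\<open>bounded\<close> and \<open>\<epsilon> \<le> lam n\<close> keep the step
    size away from zero, \<open>\<epsilon> \<le> \<bar>\<beta>\<bar> * \<theta> n\<close>, while
    \<open>p n - ph n\<close> is \<open>\<theta> n *\<^sub>R w n\<close>.\<close>
  moreover have "norm (w n) \<le> \<bar>\<beta>\<bar> / \<epsilon> * norm (p n - ph n)" for n
  proof (cases "w n = 0")
    case False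
    have W: "(norm (w n))\<^sup>2 \<le> \<bar>\<beta>\<bar> * D n"
      using bounded[of n] mult_right_mono[OF abs_ge_self[of \<beta>] D0[of n]] by (simp add: D_def)
    have "\<epsilon> * (norm (w n))\<^sup>2 \<le> lam n * (\<bar>\<beta>\<bar> * D n)"
      using relax(1) relax(2)[OF False] W by (intro mult_mono) auto
    also have "\<dots> = \<bar>\<beta>\<bar> * \<theta> n * (norm (w n))\<^sup>2"
      using False relax(3)[OF False] by (simp add: D_def)
    finally have "\<epsilon> \<le> \<bar>\<beta>\<bar> * \<theta> n"
      using False by simp
    then have "\<epsilon> * norm (w n) \<le> \<bar>\<beta>\<bar> * \<theta> n * norm (w n)"
      by (intro mult_right_mono) auto
    also have "\<dots> \<le> \<bar>\<beta>\<bar> * norm (p n - ph n)"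
      by (simp add: half abs_mult mult.assoc mult_left_mono mult_right_mono)
    finally show ?thesis
      using relax(1) by (simp add: field_simps)
  qed (use relax(1) in auto)
  ultimately have w0: "w \<longlonglongrightarrow> 0"
    by (intro Lim_null_comparison[of w "\<lambda>n. \<bar>\<beta>\<bar> / \<epsilon> * norm (p n - ph n)"] tendsto_mult_right_zero) auto
  have "norm (p n - q n) \<le> norm (w n) / \<alpha>" for n
  proof -
    have "norm (p n - q n) * (\<alpha> * norm (p n - q n)) \<le> norm (p n - q n) * norm (w n)"
      using order.trans[OF coercive(2) norm_cauchy_schwarz] by (simp add: power2_eq_square algebra_simps)
    then show ?thesis
      using coercive(1) by (cases "p n = q n") (auto simp: field_simps)
  qed
  moreover have "(\<lambda>n. norm (w n) / \<alpha>) \<longlonglongrightarrow> 0"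
    using w0 by (intro tendsto_divide_zero tendsto_norm_zero)
  ultimately have pq0: "(\<lambda>n. p n - q n) \<longlonglongrightarrow> 0"
    by (intro Lim_null_comparison[of "\<lambda>n. p n - q n" "\<lambda>n. norm (w n) / \<alpha>"]) auto
  define R where "R = sqrt \<Delta>"
  have pR: "norm (p 0 - p n) \<le> R" for n
    using \<Delta>(2)[of n] by (simp add: R_def \<delta>_def real_le_rsqrt)
  \<comment> \<open>The factor \<open>1 + norm y\<close> lets a single index \<open>n\<close> serve
    all graph points at once, since \<open>norm (q n - y)\<close> grows at most linearly in
    \<open>norm y\<close>. The slack in the radius is needed because \<open>q n\<close>, not
    \<open>p n\<close>, belongs to the graph.\<close>
  define S where "S j = {c \<in> X. norm (p 0 - c) \<le> R + 1 / real (Suc j) \<and>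
    (\<forall>y y'. (y, y') \<in> Gr \<longrightarrow> inner (c - y) y' \<le> (1 + norm y) * (1 / real (Suc j)))}" for j
  have "(\<Inter>j. S j) \<noteq> {}"
  proof (rule nested_closed_convex_Inter_nonempty[OF X(1)])
    have move: "inner (c - y) y' \<le> e \<longleftrightarrow> inner y' c \<le> e + inner y' y" for c y y' :: 'a and e
      by (simp add: inner_diff_left inner_commute algebra_simps)
    have S_eq: "S j = X \<inter> cball (p 0) (R + 1 / real (Suc j))
        \<inter> (\<Inter>(y, y')\<in>Gr. {c. inner y' c \<le> (1 + norm y) * (1 / real (Suc j)) + inner y' y})" for j
      unfolding S_def move by (auto simp: dist_norm)
    show "closed (S j)" for j
      unfolding S_eq using complete_imp_closed[OF X(1)]
      by (intro closed_Int closed_INT closed_cball) (auto simp: closed_halfspace_le simp del: of_nat_Suc)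
    show "convex (S j)" for j
      unfolding S_eq using subspace_imp_convex[OF X(2)]
      by (intro convex_Int convex_INT convex_cball) (auto simp: convex_halfspace_le simp del: of_nat_Suc)
    show "decseq S"
    proof (unfold decseq_def, intro allI impI subsetI)
      fix j k c assume "j \<le> k" and c: "c \<in> S k"
      then have le: "1 / real (Suc k) \<le> 1 / real (Suc j)"
        by (simp add: frac_le)
      have "inner (c - y) y' \<le> (1 + norm y) * (1 / real (Suc j))" if "(y, y') \<in> Gr" for y y'
      proof -
        have "inner (c - y) y' \<le> (1 + norm y) * (1 / real (Suc k))"
          using c that unfolding S_def by blast
        also have "\<dots> \<le> (1 + norm y) * (1 / real (Suc j))"
          using le by (intro mult_left_mono) auto
        finally show ?thesis .
      qed
      moreover have "norm (p 0 - c) \<le> R + 1 / real (Suc j)"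
        using c le unfolding S_def by (simp del: of_nat_Suc)
      ultimately show "c \<in> S j"
        using c unfolding S_def by blast
    qed
    show "S j \<noteq> {}" for j
    proof -
      define e where "e = 1 / real (Suc j)"
      have "e > 0"
        by (simp add: e_def)
      define M where "M = norm (p 0) + R + e"
      have "M \<ge> 0"
        using pR[of 0] \<open>e > 0\<close> by (simp add: M_def)
      have "(\<lambda>n. (M + 1) * norm (w n)) \<longlonglongrightarrow> 0"
        using w0 by (intro tendsto_mult_right_zero tendsto_norm_zero)
      then have "\<forall>\<^sub>F n in sequentially. (M + 1) * norm (w n) < e"
        using \<open>e > 0\<close> by (rule order_tendstoD)
      moreover have "\<forall>\<^sub>F n in sequentially. norm (p n - q n) < e"
        using tendsto_norm_zero[OF pq0] \<open>e > 0\<close> by (rule order_tendstoD)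
      ultimately have "\<forall>\<^sub>F n in sequentially. q n \<in> S j"
      proof eventually_elim
        case (elim n)
        have near: "norm (p 0 - q n) \<le> R + e"
          using norm_triangle_ineq[of "p 0 - p n" "p n - q n"] pR[of n] elim(2) by simp
        then have qM: "norm (q n) \<le> M"
          using norm_triangle_ineq4[of "p 0" "p 0 - q n"] by (simp add: M_def)
        have "inner (q n - y) y' \<le> (1 + norm y) * e" if "(y, y') \<in> Gr" for y y'
        proof -
          \<comment> \<open>Monotonicity between \<open>(q n, w n)\<close> and
            \<open>(y, y')\<close> replaces the arbitrary \<open>y'\<close> by the small vector
            \<open>w n\<close>.\<close>
          have "inner (q n - y) y' \<le> inner (q n - y) (w n)"
            using mono[OF qw[of n] that] by (simp add: inner_diff_right)
          also have "\<dots> \<le> norm (q n - y) * norm (w n)"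
            by (rule norm_cauchy_schwarz)
          also have "\<dots> \<le> ((1 + norm y) * (M + 1)) * norm (w n)"
          proof (rule mult_right_mono)
            have "norm (q n - y) \<le> M + norm y"
              using norm_triangle_ineq4[of "q n" y] qM by simp
            also have "\<dots> \<le> (1 + norm y) * (M + 1)"
              using \<open>M \<ge> 0\<close> by (simp add: algebra_simps)
            finally show "norm (q n - y) \<le> (1 + norm y) * (M + 1)" .
          qed simp
          also have "\<dots> = (1 + norm y) * ((M + 1) * norm (w n))"
            by simp
          also have "\<dots> \<le> (1 + norm y) * e"
            using elim(1) by (intro mult_left_mono) auto
          finally show ?thesis .
        qed
        then show ?case
          using near qX by (auto simp: S_def e_def simp del: of_nat_Suc)
      qed
      then show ?thesis
        by (auto simp: eventually_sequentially)
    qed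
    show "norm c \<le> norm (p 0) + R + 1" if "c \<in> S j" for c j
    proof -
      have "norm (p 0 - c) \<le> R + 1 / real (Suc j)"
        using that by (simp add: S_def)
      moreover have "1 / real (Suc j) \<le> 1"
        by simp
      moreover have "norm c \<le> norm (p 0) + norm (p 0 - c)"
        using norm_triangle_ineq4[of "p 0" "p 0 - c"] by simp
      ultimately show ?thesis
        by linarith
    qed
  qed (auto simp: S_def)
  then obtain c where c: "\<And>j. c \<in> S j"
    by auto
  have lim1: "(\<lambda>j. 1 / real (Suc j)) \<longlonglongrightarrow> 0"
    by (rule LIMSEQ_Suc[OF lim_1_over_n])
  have "norm (p 0 - c) \<le> R + 0"
    using c by (intro LIMSEQ_le_const[OF tendsto_add[OF tendsto_const lim1]]) (auto simp: S_def simp del: of_nat_Suc)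
  moreover have "c \<in> Z"
  proof -
    have "inner (c - y) y' \<le> (1 + norm y) * 0" if "(y, y') \<in> Gr" for y y'
      using c that by (intro LIMSEQ_le_const[OF tendsto_mult[OF tendsto_const lim1]]) (auto simp: S_def simp del: of_nat_Suc)
    then show ?thesis
      using c[of 0] by (fastforce simp: Z S_def inner_diff_left)
  qed
  \<comment> \<open>The common point \<open>c\<close> is in \<open>Z\<close> at distance at most
    \<open>R\<close>, so the nearest point \<open>pbar\<close> is too. With \<open>gap\<close>, the
    squared error is at most \<open>\<Delta> - \<delta> n\<close>.\<close>
  ultimately have "norm (p 0 - pbar) \<le> R"
    using best(2) by fastforce
  moreover have "\<Delta> \<ge> 0"
    using \<Delta>(2)[of 0] by (simp add: \<delta>_def)
  ultimately have "(norm (p 0 - pbar))\<^sup>2 \<le> \<Delta>"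
    by (metis R_def norm_ge_zero power_mono real_sqrt_pow2)
  then have "(norm (p n - pbar))\<^sup>2 \<le> \<Delta> - \<delta> n" for n
    using gap[of n] by simp
  then have "norm (p n - pbar) \<le> sqrt (\<Delta> - \<delta> n)" for n
    by (simp add: real_le_rsqrt)
  moreover have "(\<lambda>n. sqrt (\<Delta> - \<delta> n)) \<longlonglongrightarrow> sqrt (\<Delta> - \<Delta>)"
    by (intro tendsto_intros \<Delta>)
  ultimately have "(\<lambda>n. p n - pbar) \<longlonglongrightarrow> 0"
    by (intro Lim_null_comparison[of "\<lambda>n. p n - pbar" "\<lambda>n. sqrt (\<Delta> - \<delta> n)"]) auto
  then show ?thesis
    by (simp add: LIM_zero_iff)
qed

section \<open>Composite monotone inclusions\<close>

text \<open>Minty's characterization: a monotone operator is maximally monotone iff the sum of the identity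
  and the operator is surjective.\<close>

definition maximally_monotone :: "'a::real_inner set \<Rightarrow> ('a \<times> 'a) set \<Rightarrow> bool" where
  "maximally_monotone X T \<longleftrightarrow> T \<subseteq> X \<times> X \<and>
    (\<forall>y y' u u'. (y, y') \<in> T \<longrightarrow> (u, u') \<in> T \<longrightarrow> 0 \<le> inner (y - u) (y' - u')) \<and>
    (\<forall>u\<in>X. \<exists>y. (y, u - y) \<in> T)"

lemma maximally_monotoneI:
  assumes "T \<subseteq> X \<times> X" "\<And>y y' u u'. (y, y') \<in> T \<Longrightarrow> (u, u') \<in> T \<Longrightarrow> 0 \<le> inner (y - u) (y' - u')"
    "\<And>u. u \<in> X \<Longrightarrow> \<exists>y. (y, u - y) \<in> T"
  shows "maximally_monotone X T"
  using assms unfolding maximally_monotone_def by blast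

lemma maximally_monotoneD:
  assumes "maximally_monotone X T"
  shows "T \<subseteq> X \<times> X" "\<And>y y' u u'. (y, y') \<in> T \<Longrightarrow> (u, u') \<in> T \<Longrightarrow> 0 \<le> inner (y - u) (y' - u')"
    "\<And>u. u \<in> X \<Longrightarrow> \<exists>y. (y, u - y) \<in> T"
  using assms unfolding maximally_monotone_def by blast+

text \<open>The graph of \<open>(x, v) \<mapsto> (A x + \<Lambda>\<^sup>* v) \<times> (B\<^sup>-\<^sup>1 v - \<Lambda> x)\<close>\<close>

definition kt_graph :: "('a::real_inner \<times> 'a) set \<Rightarrow> ('b::real_inner \<times> 'b) set \<Rightarrow> ('a \<Rightarrow> 'b) \<Rightarrow> ('b \<Rightarrow> 'a)
    \<Rightarrow> (('a \<times> 'b) \<times> ('a \<times> 'b)) set" where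
  "kt_graph A B \<Lambda> \<Lambda>' = {((y, w'), (y' + \<Lambda>' w', w - \<Lambda> y)) | y y' w w'. (y, y') \<in> A \<and> (w, w') \<in> B}"

lemma hilbert_carrier_Times:
  assumes "hilbert_carrier X" "hilbert_carrier Y"
  shows "hilbert_carrier (X \<times> Y)"
  unfolding hilbert_carrier_def
proof
  have X: "subspace X" "complete X" and Y: "subspace Y" "complete Y"
    using assms by (auto simp: hilbert_carrier_def)
  show "subspace (X \<times> Y)"
    using X Y by (auto simp: subspace_def zero_prod_def)
  show "complete (X \<times> Y)"
  proof (rule completeI)
    fix u :: "nat \<Rightarrow> 'a \<times> 'b" assume u: "\<forall>n. u n \<in> X \<times> Y" "Cauchy u"
    obtain c where c: "c \<in> X" "(\<lambda>n. fst (u n)) \<longlonglongrightarrow> c"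
      using completeE[OF X(2) _ Cauchy_fst[OF u(2)]] u(1) by (auto simp: mem_Times_iff)
    obtain d where d: "d \<in> Y" "(\<lambda>n. snd (u n)) \<longlonglongrightarrow> d"
      using completeE[OF Y(2) _ Cauchy_snd[OF u(2)]] u(1) by (auto simp: mem_Times_iff)
    show "\<exists>l\<in>X \<times> Y. u \<longlonglongrightarrow> l"
      using tendsto_Pair[OF c(2) d(2)] c(1) d(1) by (intro bexI[of _ "(c, d)"]) auto
  qed
qed

text \<open>The algorithm with one primal and one dual space, and with proximal points replaced by
  graph points of \<open>A\<close> and \<open>B\<close>. The hypotheses \<open>a\<close> and
  \<open>b\<close> are conditional because the iterates are shown to stay in the carriers only in
  the course of the convergence proof.\<close>

theorem primal_dual_converges:
  fixes x a s :: "nat \<Rightarrow> 'a::real_inner" and v l b t :: "nat \<Rightarrow> 'b::real_inner"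
    and A :: "('a \<times> 'a) set" and B :: "('b \<times> 'b) set"
  assumes X: "hilbert_carrier X" and Y: "hilbert_carrier Y"
    and \<Lambda>: "\<Lambda> ` X \<subseteq> Y" "\<And>y w. y \<in> X \<Longrightarrow> w \<in> X \<Longrightarrow> \<Lambda> (y - w) = \<Lambda> y - \<Lambda> w"
      "\<And>y. y \<in> X \<Longrightarrow> norm (\<Lambda> y) \<le> C * norm y"
    and \<Lambda>': "\<Lambda>' ` Y \<subseteq> X" "\<And>y w. y \<in> X \<Longrightarrow> w \<in> Y \<Longrightarrow> inner (\<Lambda> y) w = inner y (\<Lambda>' w)"
    and A: "maximally_monotone X A" and B: "maximally_monotone Y B"
    and Z: "Z = {(y, w). y \<in> X \<and> w \<in> Y \<and> (y, - \<Lambda>' w) \<in> A \<and> (\<Lambda> y, w) \<in> B}"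
    and init: "x 0 \<in> X" "v 0 \<in> Y"
    and eps: "0 < \<epsilon>" and gamma: "\<And>n. \<gamma> n \<in> {\<epsilon>..1/\<epsilon>}" and mu: "\<And>n. \<mu> n \<in> {\<epsilon>..1/\<epsilon>}"
    and a: "\<And>n. x n \<in> X \<Longrightarrow> v n \<in> Y \<Longrightarrow> (a n, (1 / \<gamma> n) *\<^sub>R (x n - a n) - \<Lambda>' (v n)) \<in> A"
    and l: "\<And>n. l n = \<Lambda> (x n)"
    and b: "\<And>n. x n \<in> X \<Longrightarrow> v n \<in> Y \<Longrightarrow> (b n, (1 / \<mu> n) *\<^sub>R (l n - b n) + v n) \<in> B"
    and t: "\<And>n. t n = b n - \<Lambda> (a n)"
    and s: "\<And>n. s n = (1 / \<gamma> n) *\<^sub>R (x n - a n) + (1 / \<mu> n) *\<^sub>R \<Lambda>' (l n - b n)"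
    and tau: "\<And>n. \<tau> n = (norm (s n))\<^sup>2 + (norm (t n))\<^sup>2"
    and lam: "\<And>n. \<tau> n > 0 \<Longrightarrow> lam n \<in> {\<epsilon>..1}"
    and theta: "\<And>n. \<tau> n > 0 \<Longrightarrow>
      \<theta> n = lam n * ((1 / \<gamma> n) * (norm (x n - a n))\<^sup>2 + (1 / \<mu> n) * (norm (l n - b n))\<^sup>2) / \<tau> n"
    and half: "\<And>n. xh n = x n - \<theta> n *\<^sub>R s n" "\<And>n. vh n = v n - \<theta> n *\<^sub>R t n"
    and step: "\<And>n. haugazeau_step (x 0, v 0) (x n, v n) (xh n, vh n) (x (Suc n), v (Suc n))"
    and best: "pbar \<in> Z" "\<And>c. c \<in> Z \<Longrightarrow> norm ((x 0, v 0) - pbar) \<le> norm ((x 0, v 0) - c)"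
  shows "(\<lambda>n. (x n, v n)) \<longlonglongrightarrow> pbar"
proof -
  have subX: "subspace X" and subY: "subspace Y"
    using X Y by (auto simp: hilbert_carrier_def)
  note A = maximally_monotoneD[OF A] and B = maximally_monotoneD[OF B]
  note \<Lambda>_in = subsetD[OF \<Lambda>(1) imageI] and \<Lambda>'_in = subsetD[OF \<Lambda>'(1) imageI]
  \<comment> \<open>Uniqueness of the adjoint; the linearity of \<open>\<Lambda>'\<close> used for
    \<open>s n\<close> is derived from it.\<close>
  have \<Lambda>'_eqI: "u = \<Lambda>' w" if "u \<in> X" "w \<in> Y" "\<And>y. y \<in> X \<Longrightarrow> inner y u = inner (\<Lambda> y) w" for u w
  proof -
    have "\<Lambda>' w \<in> X"
      using \<Lambda>'(1) that(2) by blast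
    then have "u - \<Lambda>' w \<in> X"
      using subspace_diff[OF subX that(1)] by blast
    then have "inner (u - \<Lambda>' w) (u - \<Lambda>' w) = 0"
      unfolding inner_diff_right[of _ u] using that \<Lambda>'(2) by simp
    then show ?thesis
      by simp
  qed
  define M where "M = \<bar>C\<bar>"
  have \<Lambda>_bound: "norm (\<Lambda> y) \<le> M * norm y" if "y \<in> X" for y
    using \<Lambda>(3)[OF that] mult_right_mono[OF abs_ge_self[of C], of "norm y"] by (simp add: M_def)
  have \<Lambda>'_bound: "norm (\<Lambda>' w) \<le> M * norm w" if "w \<in> Y" for w
  proof -
    have "\<Lambda>' w \<in> X"
      using \<Lambda>'(1) that by blast
    then have "(norm (\<Lambda>' w))\<^sup>2 = inner (\<Lambda> (\<Lambda>' w)) w"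
      using that by (simp add: power2_norm_eq_inner \<Lambda>'(2))
    also have "\<dots> \<le> norm (\<Lambda> (\<Lambda>' w)) * norm w"
      by (rule norm_cauchy_schwarz)
    also have "\<dots> \<le> M * norm (\<Lambda>' w) * norm w"
      using \<Lambda>_bound[OF \<open>\<Lambda>' w \<in> X\<close>] by (rule mult_right_mono) simp
    finally have "norm (\<Lambda>' w) * norm (\<Lambda>' w) \<le> norm (\<Lambda>' w) * (M * norm w)"
      by (simp add: power2_eq_square mult_ac)
    then show ?thesis
      by (cases "\<Lambda>' w = 0") (auto simp: M_def)
  qed
  define Gr where "Gr = kt_graph A B \<Lambda> \<Lambda>'"
  have GrI: "((y, w'), (y' + \<Lambda>' w', w - \<Lambda> y)) \<in> Gr" if "(y, y') \<in> A" "(w, w') \<in> B" for y y' w w'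
    using that by (auto simp: Gr_def kt_graph_def)
  \<comment> \<open>By this identity the two coupling terms of \<open>Gr\<close> have opposite
    contributions to every pairing.\<close>
  have skew: "inner (y - u) (\<Lambda>' w' - \<Lambda>' z') = inner (\<Lambda> y - \<Lambda> u) (w' - z')"
    if "y \<in> X" "u \<in> X" "w' \<in> Y" "z' \<in> Y" for y u w' z'
    using that subspace_diff[OF subX that(1,2)] by (simp add: \<Lambda>(2)[symmetric] inner_diff_right \<Lambda>'(2))
  have mono: "0 \<le> inner (y - u) (y' - u')" if yy': "(y, y') \<in> Gr" and uu': "(u, u') \<in> Gr" for y y' u u'
  proof -
    obtain y1 y2 w1 w2 where y: "y = (y1, w2)" "y' = (y2 + \<Lambda>' w2, w1 - \<Lambda> y1)" "(y1, y2) \<in> A" "(w1, w2) \<in> B"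
      using yy' by (auto simp: Gr_def kt_graph_def)
    obtain u1 u2 z1 z2 where u: "u = (u1, z2)" "u' = (u2 + \<Lambda>' z2, z1 - \<Lambda> u1)" "(u1, u2) \<in> A" "(z1, z2) \<in> B"
      using uu' by (auto simp: Gr_def kt_graph_def)
    have mem: "y1 \<in> X" "u1 \<in> X" "w2 \<in> Y" "z2 \<in> Y"
      using A(1) B(1) y u by auto
    have "inner (y - u) (y' - u') = inner (y1 - u1) (y2 - u2) + inner (w1 - z1) (w2 - z2)"
      using skew[OF mem] by (simp add: y u inner_diff_left inner_diff_right inner_add_left inner_add_right inner_commute)
    then show ?thesis
      using A(2)[OF y(3) u(3)] B(2)[OF y(4) u(4)] by simp
  qed
  have Gr_sub: "Gr \<subseteq> (X \<times> Y) \<times> (X \<times> Y)"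
    using A(1) B(1) subX subY
    by (auto simp: Gr_def kt_graph_def intro!: subspace_add subspace_diff \<Lambda>_in \<Lambda>'_in)
  have Z_eq: "Z = {c \<in> X \<times> Y. \<forall>y y'. (y, y') \<in> Gr \<longrightarrow> 0 \<le> inner (y - c) y'}"
  proof (rule set_eqI)
    fix c :: "'a \<times> 'b"
    obtain cx cw where c: "c = (cx, cw)"
      by (cases c)
    show "c \<in> Z \<longleftrightarrow> c \<in> {c \<in> X \<times> Y. \<forall>y y'. (y, y') \<in> Gr \<longrightarrow> 0 \<le> inner (y - c) y'}"
    proof
      assume "c \<in> Z"
      then have cz: "cx \<in> X" "cw \<in> Y" "(cx, - \<Lambda>' cw) \<in> A" "(\<Lambda> cx, cw) \<in> B"
        by (auto simp: Z c)
      then have "(c, 0) \<in> Gr"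
        using GrI[OF cz(3,4)] by (simp add: c zero_prod_def)
      then show "c \<in> {c \<in> X \<times> Y. \<forall>y y'. (y, y') \<in> Gr \<longrightarrow> 0 \<le> inner (y - c) y'}"
        using mono cz(1,2) by (fastforce simp: c)
    next
      assume "c \<in> {c \<in> X \<times> Y. \<forall>y y'. (y, y') \<in> Gr \<longrightarrow> 0 \<le> inner (y - c) y'}"
      then have cX: "cx \<in> X" "cw \<in> Y" and above: "\<And>y y'. (y, y') \<in> Gr \<Longrightarrow> 0 \<le> inner (y - c) y'"
        by (auto simp: c)
      have mem: "cx - \<Lambda>' cw \<in> X" "\<Lambda> cx + cw \<in> Y"
        using cX by (auto intro!: subspace_diff[OF subX] subspace_add[OF subY] \<Lambda>_in \<Lambda>'_in)
      \<comment> \<open>The resolvents of \<open>A\<close> and \<open>B\<close> at these points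
        would return \<open>cx\<close> and \<open>\<Lambda> cx\<close> if \<open>c\<close> were a
        zero. Testing against the graph point they produce leaves minus the sum of the squared
        deviations, which must therefore vanish.\<close>
      obtain y where y: "(y, cx - \<Lambda>' cw - y) \<in> A"
        using A(3)[OF mem(1)] by blast
      obtain w where w: "(w, \<Lambda> cx + cw - w) \<in> B"
        using B(3)[OF mem(2)] by blast
      let ?w' = "\<Lambda> cx + cw - w"
      have yw: "y \<in> X" "?w' \<in> Y"
        using A(1) B(1) y w by auto
      have "0 \<le> inner ((y, ?w') - c) (cx - \<Lambda>' cw - y + \<Lambda>' ?w', w - \<Lambda> y)"
        by (rule above[OF GrI[OF y w]])
      also have "\<dots> = inner (y - cx) (cx - y) + inner (y - cx) (\<Lambda>' ?w' - \<Lambda>' cw) + inner (\<Lambda> cx - w) (w - \<Lambda> y)"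
        by (simp add: c inner_diff_right inner_add_right)
      also have "\<dots> = - (norm (y - cx))\<^sup>2 - (norm (w - \<Lambda> cx))\<^sup>2"
        unfolding skew[OF yw(1) cX(1) yw(2) cX(2)] power2_norm_eq_inner
        by (simp add: inner_diff_left inner_diff_right inner_commute)
      finally have "(norm (y - cx))\<^sup>2 + (norm (w - \<Lambda> cx))\<^sup>2 \<le> 0"
        by simp
      then have "y = cx" "w = \<Lambda> cx"
        by (simp_all add: sum_power2_le_zero_iff)
      then show "c \<in> Z"
        using y w cX by (simp add: Z c)
    qed
  qed
  \<comment> \<open>The primal part of \<open>q n\<close> is a point \<open>a n\<close> of the
    domain of \<open>A\<close>; the dual part is the value of \<open>B\<close> at \<open>b n\<close>
    delivered by the second proximal step.\<close>
  define q where "q n = (a n, (1 / \<mu> n) *\<^sub>R (l n - b n) + v n)" for n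
  define D where "D n = (1 / \<gamma> n) * (norm (x n - a n))\<^sup>2 + (1 / \<mu> n) * (norm (l n - b n))\<^sup>2" for n
  have iterate: "(q n, (s n, t n)) \<in> Gr" "inner ((x n, v n) - q n) (s n, t n) = D n"
    "\<epsilon> * (norm ((x n, v n) - q n))\<^sup>2 \<le> D n"
    "(norm (s n, t n))\<^sup>2 \<le> (2 + 2 * M\<^sup>2) / \<epsilon> * D n" if "(x n, v n) \<in> X \<times> Y" for n
  proof -
    have xv: "x n \<in> X" "v n \<in> Y"
      using that by auto
    have mem: "a n \<in> X" "b n \<in> Y" "l n \<in> Y"
      using a[OF xv] b[OF xv] A(1) B(1) \<Lambda>(1) xv by (auto simp: l)
    have xa: "x n - a n \<in> X" and lb: "l n - b n \<in> Y"
      using mem xv by (simp_all add: subspace_diff subX subY)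
    have \<Lambda>'_lb: "\<Lambda>' (l n - b n) \<in> X" "\<Lambda>' (v n) \<in> X"
      using \<Lambda>'(1) lb xv by auto
    have "(1 / \<mu> n) *\<^sub>R \<Lambda>' (l n - b n) + \<Lambda>' (v n) = \<Lambda>' ((1 / \<mu> n) *\<^sub>R (l n - b n) + v n)"
      using \<Lambda>'_lb lb xv by (intro \<Lambda>'_eqI)
        (simp_all add: subspace_add subspace_scale subX subY inner_add_right \<Lambda>'(2))
    then have "(1 / \<gamma> n) *\<^sub>R (x n - a n) - \<Lambda>' (v n) + \<Lambda>' ((1 / \<mu> n) *\<^sub>R (l n - b n) + v n) = s n"
      by (simp add: s algebra_simps)
    then show "(q n, (s n, t n)) \<in> Gr"
      using GrI[OF a[OF xv] b[OF xv]] by (simp add: q_def t)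
    have t': "t n = \<Lambda> (x n - a n) - (l n - b n)"
      using xv mem by (simp add: t l \<Lambda>(2))
    have "inner (x n - a n) (\<Lambda>' (l n - b n)) = inner (\<Lambda> (x n - a n)) (l n - b n)"
      using xa lb by (simp add: \<Lambda>'(2))
    then show "inner ((x n, v n) - q n) (s n, t n) = D n"
      by (simp add: q_def D_def s t' power2_norm_eq_inner inner_add_right inner_diff_right[of _ "\<Lambda> (x n - a n)"]
          inner_commute[of "\<Lambda> (x n - a n)"])
    define P Q g h where "P = (norm (x n - a n))\<^sup>2" and "Q = (norm (l n - b n))\<^sup>2" and "g = 1 / \<gamma> n" and "h = 1 / \<mu> n"
    have gh: "\<epsilon> \<le> g" "\<epsilon> * g \<le> 1" "\<epsilon> \<le> h" "\<epsilon> * h \<le> 1" "0 \<le> P" "0 \<le> Q"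
      using gamma[of n] mu[of n] eps by (auto simp: g_def h_def P_def Q_def field_simps)
    have D: "D n = g * P + h * Q"
      by (simp add: D_def P_def Q_def g_def h_def)
    \<comment> \<open>For \<open>c\<close> between \<open>\<epsilon>\<close> and
      \<open>1 / \<epsilon>\<close>, both 1 and \<open>c\<^sup>2\<close> are at most
      \<open>c / \<epsilon>\<close>. This explains the \<open>\<epsilon>\<close> in both estimates;
      the 2 in the second comes from \<open>sum_sq\<close> and \<open>M\<^sup>2\<close> from the
      bounds on \<open>\<Lambda>\<close> and \<open>\<Lambda>'\<close>.\<close>
    have weight: "\<epsilon> * (c\<^sup>2 * E) \<le> c * E" "\<epsilon> * E \<le> c * E" if "\<epsilon> \<le> c" "\<epsilon> * c \<le> 1" "0 \<le> E" for c E
      using that eps mult_right_mono[OF that(2), of "c * E"] mult_right_mono[OF that(1,3)]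
      by (simp_all add: power2_eq_square mult_ac)
    have "(norm ((x n, v n) - q n))\<^sup>2 = P + h\<^sup>2 * Q"
      by (simp add: q_def norm_Pair P_def Q_def h_def power_divide)
    then show "\<epsilon> * (norm ((x n, v n) - q n))\<^sup>2 \<le> D n"
      using weight(2)[OF gh(1,2,5)] weight(1)[OF gh(3,4,6)] by (simp add: D distrib_left)
    have sum_sq: "(norm (c + d))\<^sup>2 \<le> 2 * (norm c)\<^sup>2 + 2 * (norm d)\<^sup>2" for c d :: "'c::real_inner"
      using zero_le_power2[of "norm (c - d)"]
      by (simp add: power2_norm_eq_inner inner_add_left inner_add_right inner_diff_left inner_diff_right inner_commute)
    have "(norm (\<Lambda> (x n - a n)))\<^sup>2 \<le> (M * norm (x n - a n))\<^sup>2" "(norm (\<Lambda>' (l n - b n)))\<^sup>2 \<le> (M * norm (l n - b n))\<^sup>2"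
      by (intro power_mono \<Lambda>_bound \<Lambda>'_bound xa lb norm_ge_zero)+
    then have \<Lambda>_sq: "(norm (\<Lambda> (x n - a n)))\<^sup>2 \<le> M\<^sup>2 * P" "(norm (\<Lambda>' (l n - b n)))\<^sup>2 \<le> M\<^sup>2 * Q"
      by (simp_all add: P_def Q_def power_mult_distrib)
    have "(norm (s n))\<^sup>2 \<le> 2 * (g\<^sup>2 * P) + 2 * (h\<^sup>2 * (norm (\<Lambda>' (l n - b n)))\<^sup>2)"
      using sum_sq[of "(1 / \<gamma> n) *\<^sub>R (x n - a n)" "(1 / \<mu> n) *\<^sub>R \<Lambda>' (l n - b n)"]
      by (simp add: s g_def h_def P_def power_divide)
    also have "\<dots> \<le> 2 * (g\<^sup>2 * P) + 2 * (h\<^sup>2 * (M\<^sup>2 * Q))"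
      using \<Lambda>_sq(2) by (intro add_left_mono mult_left_mono) auto
    finally have s_sq: "(norm (s n))\<^sup>2 \<le> 2 * (g\<^sup>2 * P) + 2 * (h\<^sup>2 * (M\<^sup>2 * Q))" .
    have t_sq: "(norm (t n))\<^sup>2 \<le> 2 * (M\<^sup>2 * P) + 2 * Q"
      using sum_sq[of "\<Lambda> (x n - a n)" "- (l n - b n)", unfolded norm_minus_cancel add_uminus_conv_diff] \<Lambda>_sq(1)
      by (simp add: t' Q_def)
    have "\<epsilon> * (norm (s n, t n))\<^sup>2 \<le> \<epsilon> * (2 * (g\<^sup>2 * P) + 2 * (h\<^sup>2 * (M\<^sup>2 * Q)) + (2 * (M\<^sup>2 * P) + 2 * Q))"
      using s_sq t_sq eps by (intro mult_left_mono) (simp_all add: norm_Pair)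
    also have "\<dots> = 2 * (\<epsilon> * (g\<^sup>2 * P)) + 2 * (\<epsilon> * (h\<^sup>2 * (M\<^sup>2 * Q))) + (2 * (\<epsilon> * (M\<^sup>2 * P)) + 2 * (\<epsilon> * Q))"
      by (simp add: algebra_simps)
    also have "\<dots> \<le> 2 * (g * P) + 2 * (h * (M\<^sup>2 * Q)) + (2 * (g * (M\<^sup>2 * P)) + 2 * (h * Q))"
      using gh by (intro add_mono mult_left_mono weight) simp_all
    also have "\<dots> = (2 + 2 * M\<^sup>2) * D n"
      by (simp add: D algebra_simps)
    finally show "(norm (s n, t n))\<^sup>2 \<le> (2 + 2 * M\<^sup>2) / \<epsilon> * D n"
      using eps by (simp add: field_simps)
  qed
  show ?thesis
  proof (rule haugazeau_monotone_converges[of "X \<times> Y" Gr Z "\<lambda>n. (x n, v n)" q "\<lambda>n. (s n, t n)" \<epsilon>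
        "(2 + 2 * M\<^sup>2) / \<epsilon>" "\<lambda>n. (xh n, vh n)" \<theta> \<epsilon> lam pbar, OF _ _ mono Gr_sub Z_eq _ _ eps _ _ _ eps])
    show "complete (X \<times> Y)" "subspace (X \<times> Y)"
      using hilbert_carrier_Times[OF X Y] by (auto simp: hilbert_carrier_def)
    have tau': "\<tau> n = (norm (s n, t n))\<^sup>2" for n
      by (simp add: tau norm_Pair)
    show "lam n \<in> {\<epsilon>..1}" if "(s n, t n) \<noteq> 0" for n
      using lam[of n] that by (simp add: tau')
    show "\<theta> n = lam n * inner ((x n, v n) - q n) (s n, t n) / (norm (s n, t n))\<^sup>2"
      if "(x n, v n) \<in> X \<times> Y" "(s n, t n) \<noteq> 0" for n
      using theta[of n] that iterate(2)[OF that(1)] by (simp add: tau' D_def)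
  qed (use init iterate half step best in auto)
qed

section \<open>Finitely supported sequences as an inner product space\<close>

text \<open>One type serves tuples of every length, and finite support makes the inner product a
  finite sum. The type need not be complete: completeness is a property of the carriers inside
  it.\<close>

typedef (overloaded) 'a finseq = "{f :: nat \<Rightarrow> 'a::real_inner. finite {i. f i \<noteq> 0}}"
  morphisms seq_of Finseq
  by (rule exI[of _ "\<lambda>_. 0"]) simp

setup_lifting type_definition_finseq

lemma finite_support_seq_of: "finite {i. seq_of x i \<noteq> 0}"
  using seq_of[of x] by simp

lemma finite_support_combine:
  fixes h :: "'a::real_inner \<Rightarrow> 'a \<Rightarrow> 'a"
  assumes "finite {i. f i \<noteq> 0}" "finite {i. g i \<noteq> 0}" "h 0 0 = 0"
  shows "finite {i::nat. h (f i) (g i) \<noteq> 0}"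
  by (rule finite_subset[OF _ finite_UnI[OF assms(1,2)]]) (use assms(3) in force)

instantiation finseq :: (real_inner) real_inner
begin

lift_definition zero_finseq :: "'a finseq" is "\<lambda>_. 0"
  by simp

lift_definition plus_finseq :: "'a finseq \<Rightarrow> 'a finseq \<Rightarrow> 'a finseq" is "\<lambda>f g i. f i + g i"
  by (rule finite_support_combine) auto

lift_definition minus_finseq :: "'a finseq \<Rightarrow> 'a finseq \<Rightarrow> 'a finseq" is "\<lambda>f g i. f i - g i"
  by (rule finite_support_combine) auto

lift_definition uminus_finseq :: "'a finseq \<Rightarrow> 'a finseq" is "\<lambda>f i. - f i"
  by simp

lift_definition scaleR_finseq :: "real \<Rightarrow> 'a finseq \<Rightarrow> 'a finseq" is "\<lambda>c f i. c *\<^sub>R f i"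
  by (rule finite_subset) auto

definition inner_finseq :: "'a finseq \<Rightarrow> 'a finseq \<Rightarrow> real" where
  "inner_finseq x y = (\<Sum>i | seq_of x i \<noteq> 0. inner (seq_of x i) (seq_of y i))"

definition norm_finseq :: "'a finseq \<Rightarrow> real" where
  "norm_finseq x = sqrt (inner x x)"

definition sgn_finseq :: "'a finseq \<Rightarrow> 'a finseq" where
  "sgn_finseq x = inverse (norm x) *\<^sub>R x"

definition dist_finseq :: "'a finseq \<Rightarrow> 'a finseq \<Rightarrow> real" where
  "dist_finseq x y = norm (x - y)"

definition uniformity_finseq :: "('a finseq \<times> 'a finseq) filter" where
  "uniformity_finseq = (INF e\<in>{0<..}. principal {(x, y). dist x y < e})"

definition open_finseq :: "'a finseq set \<Rightarrow> bool" where
  "open_finseq U = (\<forall>x\<in>U. eventually (\<lambda>(x', y). x' = x \<longrightarrow> y \<in> U) uniformity)"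

text \<open>The defining sum runs over the support of the first argument only. Passing to a common
  finite index set makes symmetry and additivity termwise.\<close>

lemma inner_finseq_superset:
  assumes "finite S" "{i. seq_of x i \<noteq> 0} \<subseteq> S"
  shows "inner x y = (\<Sum>i\<in>S. inner (seq_of x i) (seq_of y i))"
  unfolding inner_finseq_def using assms by (intro sum.mono_neutral_left) auto

instance
proof
  fix x y z :: "'a finseq" and c d :: real
  show "x + y + z = x + (y + z)" "x + y = y + x" "0 + x = x" "- x + x = 0" "x - y = x + - y"
    "c *\<^sub>R (x + y) = c *\<^sub>R x + c *\<^sub>R y" "(c + d) *\<^sub>R x = c *\<^sub>R x + d *\<^sub>R x"
    "c *\<^sub>R d *\<^sub>R x = (c * d) *\<^sub>R x" "1 *\<^sub>R x = x"
    by (transfer; auto simp: algebra_simps)+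
  define S where "S = {i. seq_of x i \<noteq> 0} \<union> {i. seq_of y i \<noteq> 0}"
  have S: "finite S" "{i. seq_of x i \<noteq> 0} \<subseteq> S" "{i. seq_of y i \<noteq> 0} \<subseteq> S"
    by (auto simp: S_def finite_support_seq_of)
  have S': "{i. seq_of (x + y) i \<noteq> 0} \<subseteq> S" "{i. seq_of (c *\<^sub>R x) i \<noteq> 0} \<subseteq> S"
    by (auto simp: S_def plus_finseq.rep_eq scaleR_finseq.rep_eq)
  show "inner x y = inner y x"
    by (simp add: inner_finseq_superset[OF S(1,2)] inner_finseq_superset[OF S(1,3)] inner_commute)
  show "inner (x + y) z = inner x z + inner y z"
    by (simp add: inner_finseq_superset[OF S(1,2)] inner_finseq_superset[OF S(1,3)]
        inner_finseq_superset[OF S(1) S'(1)] plus_finseq.rep_eq inner_add_left sum.distrib)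
  show "inner (c *\<^sub>R x) y = c * inner x y"
    by (simp add: inner_finseq_superset[OF S(1,2)] inner_finseq_superset[OF S(1) S'(2)]
        scaleR_finseq.rep_eq sum_distrib_left)
  show "0 \<le> inner x x"
    by (simp add: inner_finseq_def sum_nonneg)
  have "inner x x = 0 \<longleftrightarrow> (\<forall>i. seq_of x i = 0)"
    unfolding inner_finseq_def by (subst sum_nonneg_eq_0_iff) (auto simp: finite_support_seq_of)
  also have "\<dots> \<longleftrightarrow> x = 0"
    by transfer auto
  finally show "inner x x = 0 \<longleftrightarrow> x = 0" .
qed (simp_all add: norm_finseq_def sgn_finseq_def dist_finseq_def uniformity_finseq_def open_finseq_def)

end

section \<open>Tuples as finitely supported sequences\<close>

definition tuple :: "nat \<Rightarrow> (nat \<Rightarrow> 'a::real_inner) \<Rightarrow> 'a finseq" where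
  "tuple m f = Finseq (\<lambda>i. if i \<in> {1..m} then f i else 0)"

lemma seq_of_tuple: "seq_of (tuple m f) i = (if i \<in> {1..m} then f i else 0)"
proof -
  have "finite {i. (if i \<in> {1..m} then f i else 0) \<noteq> 0}"
    by (rule finite_subset[of _ "{1..m}"]) auto
  then show ?thesis
    unfolding tuple_def by (subst Finseq_inverse) auto
qed

lemma inner_tuple: "inner (tuple m f) (tuple m g) = (\<Sum>i=1..m. inner (f i) (g i))"
  by (subst inner_finseq_superset[of "{1..m}"]) (auto simp: seq_of_tuple intro!: sum.cong split: if_splits)

lemma norm_tuple: "(norm (tuple m f))\<^sup>2 = (\<Sum>i=1..m. (norm (f i))\<^sup>2)"
  by (simp add: power2_norm_eq_inner inner_tuple)

lemma tuple_cong: "(\<And>i. i \<in> {1..m} \<Longrightarrow> f i = g i) \<Longrightarrow> tuple m f = tuple m g"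
  by (simp add: tuple_def cong: if_cong)

lemma tuple_eq_iff: "tuple m f = tuple m g \<longleftrightarrow> (\<forall>i\<in>{1..m}. f i = g i)"
  by (metis seq_of_tuple tuple_cong)

lemma tuple_add: "tuple m f + tuple m g = tuple m (\<lambda>i. f i + g i)"
  by (simp add: seq_of_inject[symmetric] plus_finseq.rep_eq seq_of_tuple fun_eq_iff)

lemma tuple_diff: "tuple m f - tuple m g = tuple m (\<lambda>i. f i - g i)"
  by (simp add: seq_of_inject[symmetric] minus_finseq.rep_eq seq_of_tuple fun_eq_iff)

lemma tuple_scaleR: "c *\<^sub>R tuple m f = tuple m (\<lambda>i. c *\<^sub>R f i)"
  by (simp add: seq_of_inject[symmetric] scaleR_finseq.rep_eq seq_of_tuple fun_eq_iff)

lemma norm_component_le_norm_tuple: "i \<in> {1..m} \<Longrightarrow> norm (f i) \<le> norm (tuple m f)"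
  by (rule power2_le_imp_le) (auto simp: norm_tuple intro: member_le_sum)

lemma norm_tuple_le: "norm (tuple m f) \<le> (\<Sum>i=1..m. norm (f i))"
proof -
  have "norm (tuple m f) = L2_set (\<lambda>i. norm (f i)) {1..m}"
    unfolding L2_set_def norm_tuple[symmetric] by simp
  also have "\<dots> \<le> (\<Sum>i=1..m. norm (f i))"
    by (rule L2_set_le_sum) simp
  finally show ?thesis .
qed

definition tuples :: "nat \<Rightarrow> (nat \<Rightarrow> 'a::real_inner set) \<Rightarrow> 'a finseq set" where
  "tuples m H = {tuple m f | f. \<forall>i\<in>{1..m}. f i \<in> H i}"

lemma tuple_in_tuples: "tuple m f \<in> tuples m H \<longleftrightarrow> (\<forall>i\<in>{1..m}. f i \<in> H i)"
  by (auto simp: tuples_def tuple_eq_iff)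

lemma tuplesE:
  assumes "u \<in> tuples m H"
  obtains f where "u = tuple m f" "\<And>i. i \<in> {1..m} \<Longrightarrow> f i \<in> H i"
  using assms by (auto simp: tuples_def)

text \<open>Each component of a Cauchy sequence of tuples is Cauchy, and convergence of the finitely
  many components gives convergence in norm through \<open>norm_tuple_le\<close>.\<close>

lemma hilbert_carrier_tuples:
  assumes H: "\<And>i. i \<in> {1..m} \<Longrightarrow> hilbert_carrier (H i)"
  shows "hilbert_carrier (tuples m H)"
  unfolding hilbert_carrier_def
proof
  have sub: "subspace (H i)" and compl: "complete (H i)" if "i \<in> {1..m}" for i
    using H[OF that] by (auto simp: hilbert_carrier_def)
  show "subspace (tuples m H)"
  proof (rule subspaceI)
    have "tuple m (\<lambda>_. 0) = (0 :: 'a finseq)"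
      by (simp add: seq_of_inject[symmetric] zero_finseq.rep_eq seq_of_tuple fun_eq_iff)
    then show "0 \<in> tuples m H"
      using sub by (metis subspace_0 tuple_in_tuples)
  qed (auto elim!: tuplesE simp: tuple_add tuple_scaleR tuple_in_tuples sub subspace_add subspace_scale)
  show "complete (tuples m H)"
  proof (rule completeI)
    fix u :: "nat \<Rightarrow> 'a finseq" assume u: "\<forall>n. u n \<in> tuples m H" and "Cauchy u"
    then have "\<exists>f. u n = tuple m f \<and> (\<forall>i\<in>{1..m}. f i \<in> H i)" for n
      by (auto simp: tuples_def)
    note ex = someI_ex[OF this]
    define f where "f n = (SOME f. u n = tuple m f \<and> (\<forall>i\<in>{1..m}. f i \<in> H i))" for n
    have uf: "u = (\<lambda>n. tuple m (f n))" and fH: "\<And>n i. i \<in> {1..m} \<Longrightarrow> f n i \<in> H i"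
      using ex by (auto simp: f_def)
    have "\<exists>c. c \<in> H i \<and> (\<lambda>n. f n i) \<longlonglongrightarrow> c" if i: "i \<in> {1..m}" for i
    proof -
      have "dist (f n i) (f k i) \<le> dist (u n) (u k)" for n k
        unfolding uf dist_norm tuple_diff using norm_component_le_norm_tuple[OF i, of "\<lambda>i. f n i - f k i"] by simp
      then have "Cauchy (\<lambda>n. f n i)"
        using \<open>Cauchy u\<close> unfolding Cauchy_def by (meson order.strict_trans1)
      then show ?thesis
        using completeE[OF compl[OF i], of "\<lambda>n. f n i"] fH[OF i] by blast
    qed
    note ex = someI_ex[OF this]
    define c where "c i = (SOME c. c \<in> H i \<and> (\<lambda>n. f n i) \<longlonglongrightarrow> c)" for i
    have c: "c i \<in> H i" "(\<lambda>n. f n i) \<longlonglongrightarrow> c i" if "i \<in> {1..m}" for i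
      using ex[OF that] by (simp_all add: c_def)
    have "(\<lambda>n. \<Sum>i=1..m. norm (f n i - c i)) \<longlonglongrightarrow> (\<Sum>i=1..m. norm (c i - c i))"
      by (intro tendsto_intros c)
    moreover have "norm (u n - tuple m c) \<le> (\<Sum>i=1..m. norm (f n i - c i))" for n
      unfolding uf tuple_diff by (rule norm_tuple_le)
    ultimately have "(\<lambda>n. u n - tuple m c) \<longlonglongrightarrow> 0"
      by (intro Lim_null_comparison[of "\<lambda>n. u n - tuple m c" "\<lambda>n. \<Sum>i=1..m. norm (f n i - c i)"]
          always_eventually allI) simp_all
    then show "\<exists>l\<in>tuples m H. u \<longlonglongrightarrow> l"
      using c by (auto simp: LIM_zero_iff tuple_in_tuples intro!: bexI[of _ "tuple m c"])
  qed
qed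

section \<open>Subdifferentials as monotone graphs\<close>

text \<open>The graph of the subdifferential of \<open>f\<close> at \<open>y - r\<close>, minus
  \<open>z\<close>. With \<open>r = 0\<close> it gives the primal operators, with
  \<open>z = 0\<close> the dual ones, so that both data vectors are absorbed into \<open>A\<close>
  and \<open>B\<close>.\<close>

definition shifted_subdifferential :: "'a::real_inner set \<Rightarrow> ('a \<Rightarrow> ereal) \<Rightarrow> 'a \<Rightarrow> 'a \<Rightarrow> ('a \<times> 'a) set" where
  "shifted_subdifferential H f z r = {(y, y'). y \<in> H \<and> y' + z \<in> subdifferential H f (y - r)}"

lemma shifted_subdifferential_maximally_monotone:
  assumes f: "f \<in> Gamma0 H" and H: "hilbert_carrier H" and z: "z \<in> H" and r: "r \<in> H"
  shows "maximally_monotone H (shifted_subdifferential H f z r)"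
proof (rule maximally_monotoneI)
  let ?T = "shifted_subdifferential H f z r"
  have sub: "subspace H"
    using H by (simp add: hilbert_carrier_def)
  have "y' \<in> H" if "(y, y') \<in> ?T" for y y'
    using that subspace_diff[OF sub _ z, of "y' + z"]
    by (simp add: shifted_subdifferential_def subdifferential_def)
  then show "?T \<subseteq> H \<times> H"
    by (auto simp: shifted_subdifferential_def)
  show "0 \<le> inner (y - u) (y' - u')" if "(y, y') \<in> ?T" "(u, u') \<in> ?T" for y y' u u'
    using subdifferential_monotone[OF f, of "y - r" "u - r" "y' + z" "u' + z"] that subspace_diff[OF sub _ r]
    by (simp add: shifted_subdifferential_def)
  show "\<exists>y. (y, u - y) \<in> ?T" if "u \<in> H" for u
  proof -
    have "u + z - r \<in> H"
      using sub that z r by (simp add: subspace_add subspace_diff)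
    then obtain p where p: "p \<in> H" "u + z - r - p \<in> subdifferential H f p"
      using subdifferential_resolvent[OF f H] by blast
    \<comment> \<open>Taking \<open>y = p + r\<close> undoes the translation: \<open>y - r\<close>
      is \<open>p\<close>, and \<open>u - y + z\<close> is the subgradient found there.\<close>
    then have "p + r \<in> H" "u - (p + r) + z \<in> subdifferential H f (p + r - r)"
      using sub r by (simp_all add: subspace_add algebra_simps)
    then show ?thesis
      by (auto simp: shifted_subdifferential_def)
  qed
qed

definition tuple_graph :: "nat \<Rightarrow> (nat \<Rightarrow> ('a::real_inner \<times> 'a) set) \<Rightarrow> ('a finseq \<times> 'a finseq) set" where
  "tuple_graph m T = {(tuple m y, tuple m y') | y y'. \<forall>i\<in>{1..m}. (y i, y' i) \<in> T i}"

lemma tuple_graph_iff: "(tuple m y, tuple m y') \<in> tuple_graph m T \<longleftrightarrow> (\<forall>i\<in>{1..m}. (y i, y' i) \<in> T i)"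
  unfolding tuple_graph_def by (auto simp: tuple_eq_iff)

lemma tuple_graph_maximally_monotone:
  assumes T: "\<And>i. i \<in> {1..m} \<Longrightarrow> maximally_monotone (H i) (T i)"
  shows "maximally_monotone (tuples m H) (tuple_graph m T)"
proof (rule maximally_monotoneI)
  show "tuple_graph m T \<subseteq> tuples m H \<times> tuples m H"
    using maximally_monotoneD(1)[OF T] by (fastforce simp: tuple_graph_def tuple_in_tuples)
  show "0 \<le> inner (y - u) (y' - u')" if "(y, y') \<in> tuple_graph m T" "(u, u') \<in> tuple_graph m T" for y y' u u'
    using that maximally_monotoneD(2)[OF T] by (auto simp: tuple_graph_def tuple_diff inner_tuple intro!: sum_nonneg)
  show "\<exists>y. (y, u - y) \<in> tuple_graph m T" if "u \<in> tuples m H" for u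
  proof -
    obtain h where h: "u = tuple m h" "\<And>i. i \<in> {1..m} \<Longrightarrow> h i \<in> H i"
      using tuplesE[OF \<open>u \<in> tuples m H\<close>] by blast
    define y where "y i = (SOME y. (y, h i - y) \<in> T i)" for i
    have "(y i, h i - y i) \<in> T i" if "i \<in> {1..m}" for i
      unfolding y_def using maximally_monotoneD(3)[OF T[OF that] h(2)[OF that]] by (rule someI_ex)
    then show ?thesis
      unfolding h(1) by (intro exI[of _ "tuple m y"]) (simp add: tuple_diff tuple_graph_iff)
  qed
qed

section \<open>Kuhn-Tucker points solve both problems\<close>

lemma sum_ereal_add_le:
  fixes c :: "'i \<Rightarrow> real"
  assumes "\<And>i. i \<in> I \<Longrightarrow> ereal (c i) + F i \<le> F' i"
  shows "ereal (sum c I) + sum F I \<le> sum F' I"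
proof -
  have "ereal (sum c I) + sum F I = (\<Sum>i\<in>I. ereal (c i) + F i)"
    by (simp add: sum.distrib)
  also have "\<dots> \<le> sum F' I"
    by (rule sum_mono) (rule assms)
  finally show ?thesis .
qed

text \<open>Adds up subgradient inequalities. The corrections are real and cancel across the two
  sums, so that no infinite value of an objective is ever subtracted.\<close>

lemma two_sums_ereal_le:
  fixes c :: "'i \<Rightarrow> real" and d :: "'j \<Rightarrow> real"
  assumes "\<And>i. i \<in> I \<Longrightarrow> ereal (c i) + F i \<le> F' i" "\<And>j. j \<in> J \<Longrightarrow> ereal (d j) + E j \<le> E' j"
    and "sum c I + sum d J = 0"
  shows "sum F I + sum E J \<le> sum F' I + sum E' J"
proof -
  have "sum F I + sum E J = (ereal (sum c I) + sum F I) + (ereal (sum d J) + sum E J)"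
  proof -
    have "(ereal (sum c I) + sum F I) + (ereal (sum d J) + sum E J)
        = (ereal (sum c I) + ereal (sum d J)) + (sum F I + sum E J)"
      by (simp only: ac_simps)
    then show ?thesis
      using assms(3) by (simp add: zero_ereal_def[symmetric])
  qed
  also have "\<dots> \<le> sum F' I + sum E' J"
    using assms(1,2) by (intro add_mono sum_ereal_add_le)
  finally show ?thesis .
qed

locale kuhn_tucker_problem =
  fixes m K :: nat and H :: "nat \<Rightarrow> 'a::real_inner set" and G :: "nat \<Rightarrow> 'b::real_inner set"
    and f :: "nat \<Rightarrow> 'a \<Rightarrow> ereal" and g :: "nat \<Rightarrow> 'b \<Rightarrow> ereal"
    and z :: "nat \<Rightarrow> 'a" and r :: "nat \<Rightarrow> 'b" and L :: "nat \<Rightarrow> nat \<Rightarrow> 'a \<Rightarrow> 'b"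
  assumes H: "\<And>i. i \<in> {1..m} \<Longrightarrow> hilbert_carrier (H i)"
    and G: "\<And>k. k \<in> {1..K} \<Longrightarrow> hilbert_carrier (G k)"
    and f: "\<And>i. i \<in> {1..m} \<Longrightarrow> f i \<in> Gamma0 (H i)"
    and g: "\<And>k. k \<in> {1..K} \<Longrightarrow> g k \<in> Gamma0 (G k)"
    and z: "\<And>i. i \<in> {1..m} \<Longrightarrow> z i \<in> H i"
    and r: "\<And>k. k \<in> {1..K} \<Longrightarrow> r k \<in> G k"
    and L: "\<And>i k. i \<in> {1..m} \<Longrightarrow> k \<in> {1..K} \<Longrightarrow> bounded_linear_between (H i) (G k) (L k i)"
begin

lemma subspaces: "i \<in> {1..m} \<Longrightarrow> subspace (H i)" "k \<in> {1..K} \<Longrightarrow> subspace (G k)"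
  using H G by (auto simp: hilbert_carrier_def)

lemma sum_L_in:
  assumes "\<And>i. i \<in> {1..m} \<Longrightarrow> h i \<in> H i" "k \<in> {1..K}"
  shows "(\<Sum>i=1..m. L k i (h i)) \<in> G k"
proof (intro subspace_sum subspaces assms(2))
  fix i assume "i \<in> {1..m}"
  then show "L k i (h i) \<in> G k"
    using L[of i k] assms unfolding bounded_linear_between_def by blast
qed

lemma sum_adjoint_in:
  assumes "i \<in> {1..m}"
  shows "(\<Sum>k=1..K. adjoint_on (H i) (L k i) (w k)) \<in> H i"
  using assms H L by (intro subspace_sum subspaces adjoint_on(1))

lemma sum_L_diff:
  assumes "\<And>i. i \<in> {1..m} \<Longrightarrow> h i \<in> H i" "\<And>i. i \<in> {1..m} \<Longrightarrow> h' i \<in> H i" "k \<in> {1..K}"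
  shows "(\<Sum>i=1..m. L k i (h i - h' i)) = (\<Sum>i=1..m. L k i (h i)) - (\<Sum>i=1..m. L k i (h' i))"
  unfolding sum_subtractf[symmetric] using assms
  by (intro sum.cong refl bounded_linear_between_diff[OF L] subspaces)

lemma sum_L_bound:
  obtains C where "\<And>h. (\<And>i. i \<in> {1..m} \<Longrightarrow> h i \<in> H i) \<Longrightarrow>
    norm (tuple K (\<lambda>k. \<Sum>i=1..m. L k i (h i))) \<le> C * norm (tuple m h)"
proof -
  define c where "c k i = (SOME B. \<forall>x\<in>H i. norm (L k i x) \<le> B * norm x)" for k i
  have c: "norm (L k i x) \<le> c k i * norm x" if "i \<in> {1..m}" "k \<in> {1..K}" "x \<in> H i" for k i x
  proof -
    have "\<exists>B. \<forall>x\<in>H i. norm (L k i x) \<le> B * norm x"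
      using L[OF that(1,2)] by (simp add: bounded_linear_between_def)
    from someI_ex[OF this] show ?thesis
      using that(3) by (simp add: c_def)
  qed
  \<comment> \<open>Absolute values, because on a trivial space the chosen constant may be
    negative.\<close>
  have "norm (tuple K (\<lambda>k. \<Sum>i=1..m. L k i (h i))) \<le> (\<Sum>k=1..K. \<Sum>i=1..m. \<bar>c k i\<bar>) * norm (tuple m h)"
    if h: "\<And>i. i \<in> {1..m} \<Longrightarrow> h i \<in> H i" for h
  proof -
    have "norm (tuple K (\<lambda>k. \<Sum>i=1..m. L k i (h i))) \<le> (\<Sum>k=1..K. norm (\<Sum>i=1..m. L k i (h i)))"
      by (rule norm_tuple_le)
    also have "\<dots> \<le> (\<Sum>k=1..K. \<Sum>i=1..m. \<bar>c k i\<bar> * norm (tuple m h))"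
    proof (intro sum_mono order.trans[OF norm_sum])
      fix k i assume "k \<in> {1..K}" "i \<in> {1..m}"
      then have "norm (L k i (h i)) \<le> c k i * norm (h i)"
        using c h by blast
      also have "\<dots> \<le> \<bar>c k i\<bar> * norm (tuple m h)"
        using norm_component_le_norm_tuple[OF \<open>i \<in> {1..m}\<close>] by (intro mult_mono) auto
      finally show "norm (L k i (h i)) \<le> \<bar>c k i\<bar> * norm (tuple m h)" .
    qed
    also have "\<dots> = (\<Sum>k=1..K. \<Sum>i=1..m. \<bar>c k i\<bar>) * norm (tuple m h)"
      by (simp add: sum_distrib_right)
    finally show ?thesis .
  qed
  then show ?thesis
    using that by blast
qed

text \<open>In the direct sums, this makes the transposed block matrix of adjoints the adjoint of
  the block operator \<open>L\<close>.\<close>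

lemma sum_adjoint:
  assumes h: "\<And>i. i \<in> {1..m} \<Longrightarrow> h i \<in> H i"
  shows "(\<Sum>i=1..m. inner (h i) (\<Sum>k=1..K. adjoint_on (H i) (L k i) (w k)))
    = (\<Sum>k=1..K. inner (\<Sum>i=1..m. L k i (h i)) (w k))"
proof -
  have "(\<Sum>i=1..m. inner (h i) (\<Sum>k=1..K. adjoint_on (H i) (L k i) (w k)))
      = (\<Sum>i=1..m. \<Sum>k=1..K. inner (L k i (h i)) (w k))"
    unfolding inner_sum_right
    by (intro sum.cong refl) (rule adjoint_on(2)[OF H L h, symmetric])
  also have "\<dots> = (\<Sum>k=1..K. \<Sum>i=1..m. inner (L k i (h i)) (w k))"
    by (rule sum.swap)
  finally show ?thesis
    by (simp add: inner_sum_left)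
qed

text \<open>Inverting the subdifferential of each conjugate puts the second condition in terms of
  \<open>g k\<close> itself, the function whose proximity operator the algorithm evaluates.\<close>

lemma kuhn_tucker_set_iff:
  "(x, v) \<in> kuhn_tucker_set m K H G f g L z r \<longleftrightarrow>
    (x, v) \<in> direct_sum m K H G \<and>
    (\<forall>i\<in>{1..m}. z i - (\<Sum>k=1..K. adjoint_on (H i) (L k i) (v k)) \<in> subdifferential (H i) (f i) (x i)) \<and>
    (\<forall>k\<in>{1..K}. v k \<in> subdifferential (G k) (g k) ((\<Sum>i=1..m. L k i (x i)) - r k))"
proof (cases "(x, v) \<in> direct_sum m K H G")
  case True
  have "(\<Sum>i=1..m. L k i (x i)) - r k \<in> subdifferential (G k) (conjugate (G k) (g k)) (v k)
      \<longleftrightarrow> v k \<in> subdifferential (G k) (g k) ((\<Sum>i=1..m. L k i (x i)) - r k)" if "k \<in> {1..K}" for k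
  proof -
    have "x i \<in> H i" if "i \<in> {1..m}" for i
      using True that by (auto simp: direct_sum_def PiE_iff)
    then have "(\<Sum>i=1..m. L k i (x i)) - r k \<in> G k"
      using that r by (intro subspace_diff subspaces sum_L_in)
    moreover have "v k \<in> G k"
      using True that by (auto simp: direct_sum_def PiE_iff)
    ultimately show ?thesis
      using subdifferential_conjugateI[OF g[OF that]] subdifferential_conjugateD[OF g[OF that] G[OF that]] by blast
  qed
  then show ?thesis
    by (simp add: kuhn_tucker_set_def True)
qed (simp add: kuhn_tucker_set_def)

text \<open>Sum of the subgradient inequalities of all \<open>f i\<close> and \<open>g k\<close>:
  \<open>y - x\<close> paired with the adjoint sums cancels its images under \<open>L\<close> paired
  with \<open>v\<close>, by \<open>sum_adjoint\<close>.\<close>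

lemma kuhn_tucker_solves_primal:
  assumes "(x, v) \<in> kuhn_tucker_set m K H G f g L z r"
  shows "solves_primal m K H f g L z r x"
  unfolding solves_primal_def is_arg_min_linorder
proof (intro conjI allI impI)
  let ?u = "\<lambda>i. \<Sum>k=1..K. adjoint_on (H i) (L k i) (v k)"
  show "x \<in> (\<Pi>\<^sub>E i\<in>{1..m}. H i)"
    using assms by (simp add: kuhn_tucker_set_def direct_sum_def)
  then have x: "x i \<in> H i" if "i \<in> {1..m}" for i
    using that by (auto simp: PiE_iff)
  fix y assume "y \<in> (\<Pi>\<^sub>E i\<in>{1..m}. H i)"
  then have y: "y i \<in> H i" if "i \<in> {1..m}" for i
    using that by (auto simp: PiE_iff)
  show "primal_objective m K f g L z r x \<le> primal_objective m K f g L z r y"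
    unfolding primal_objective_def
  proof (rule two_sums_ereal_le)
    fix i assume i: "i \<in> {1..m}"
    then have "ereal (inner (y i - x i) (z i - ?u i)) + f i (x i) \<le> f i (y i)"
      using assms y[OF i] unfolding kuhn_tucker_set_iff by (blast intro: subdifferentialD)
    then show "ereal (- inner (y i - x i) (?u i)) + (f i (x i) - ereal (inner (x i) (z i)))
        \<le> f i (y i) - ereal (inner (y i) (z i))"
      by (cases "f i (x i)"; cases "f i (y i)") (auto simp: inner_diff_left inner_diff_right)
  next
    fix k assume k: "k \<in> {1..K}"
    have "(\<Sum>i=1..m. L k i (y i)) - r k \<in> G k"
      using y k r by (intro subspace_diff subspaces sum_L_in)
    then have "ereal (inner ((\<Sum>i=1..m. L k i (y i)) - r k - ((\<Sum>i=1..m. L k i (x i)) - r k)) (v k))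
        + g k ((\<Sum>i=1..m. L k i (x i)) - r k) \<le> g k ((\<Sum>i=1..m. L k i (y i)) - r k)"
      using assms k unfolding kuhn_tucker_set_iff by (blast intro: subdifferentialD)
    moreover have "(\<Sum>i=1..m. L k i (y i)) - r k - ((\<Sum>i=1..m. L k i (x i)) - r k) = (\<Sum>i=1..m. L k i (y i - x i))"
      using sum_L_diff[of y x k] x y k by simp
    ultimately show "ereal (inner (\<Sum>i=1..m. L k i (y i - x i)) (v k))
        + g k ((\<Sum>i=1..m. L k i (x i)) - r k) \<le> g k ((\<Sum>i=1..m. L k i (y i)) - r k)"
      by metis
  next
    have "(\<Sum>i=1..m. inner (y i - x i) (?u i)) = (\<Sum>k=1..K. inner (\<Sum>i=1..m. L k i (y i - x i)) (v k))"
      using x y by (intro sum_adjoint subspace_diff subspaces)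
    then show "(\<Sum>i=1..m. - inner (y i - x i) (?u i)) + (\<Sum>k=1..K. inner (\<Sum>i=1..m. L k i (y i - x i)) (v k)) = 0"
      by (simp add: sum_negf)
  qed
qed

text \<open>The same cancellation with subgradients of the conjugates: \<open>x i\<close> for the
  conjugate of \<open>f i\<close>, and the image of \<open>x\<close> minus \<open>r k\<close> for
  that of \<open>g k\<close>.\<close>

lemma kuhn_tucker_solves_dual:
  assumes "(x, v) \<in> kuhn_tucker_set m K H G f g L z r"
  shows "solves_dual m K H G f g L z r v"
  unfolding solves_dual_def is_arg_min_linorder
proof (intro conjI allI impI)
  let ?u = "\<lambda>w i. \<Sum>k=1..K. adjoint_on (H i) (L k i) (w k)"
  show "v \<in> (\<Pi>\<^sub>E k\<in>{1..K}. G k)"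
    using assms by (simp add: kuhn_tucker_set_def direct_sum_def)
  have x: "x i \<in> H i" if "i \<in> {1..m}" for i
    using assms that by (auto simp: kuhn_tucker_set_def direct_sum_def PiE_iff)
  fix w assume "w \<in> (\<Pi>\<^sub>E k\<in>{1..K}. G k)"
  then have w: "w k \<in> G k" if "k \<in> {1..K}" for k
    using that by (auto simp: PiE_iff)
  show "dual_objective m K H G f g L z r v \<le> dual_objective m K H G f g L z r w"
    unfolding dual_objective_def
  proof (rule two_sums_ereal_le)
    fix i assume i: "i \<in> {1..m}"
    have "z i - ?u v i \<in> subdifferential (H i) (f i) (x i)"
      using assms i unfolding kuhn_tucker_set_iff by blast
    then have "x i \<in> subdifferential (H i) (conjugate (H i) (f i)) (z i - ?u v i)"
      by (rule subdifferential_conjugateI[OF f[OF i] x[OF i]])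
    moreover have "z i - ?u w i \<in> H i"
      using i z by (intro subspace_diff subspaces sum_adjoint_in)
    ultimately have "ereal (inner (z i - ?u w i - (z i - ?u v i)) (x i)) + conjugate (H i) (f i) (z i - ?u v i)
        \<le> conjugate (H i) (f i) (z i - ?u w i)"
      by (rule subdifferentialD)
    then show "ereal (inner (x i) (?u v i) - inner (x i) (?u w i)) + conjugate (H i) (f i) (z i - ?u v i)
        \<le> conjugate (H i) (f i) (z i - ?u w i)"
      by (simp add: inner_diff_left inner_commute[of "x i"])
  next
    fix k assume k: "k \<in> {1..K}"
    have "ereal (inner (w k - v k) ((\<Sum>i=1..m. L k i (x i)) - r k)) + conjugate (G k) (g k) (v k)
        \<le> conjugate (G k) (g k) (w k)"
      using assms k w[OF k] unfolding kuhn_tucker_set_def by (blast intro: subdifferentialD)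
    moreover have "ereal (inner q w' - inner q v') + (c + ereal (inner v' r')) \<le> d + ereal (inner w' r')"
      if "ereal (inner (w' - v') (q - r')) + c \<le> d" for q v' w' r' :: 'b and c d
      using that by (cases c; cases d) (auto simp: inner_diff_left inner_diff_right inner_commute[of q])
    ultimately show "ereal (inner (\<Sum>i=1..m. L k i (x i)) (w k) - inner (\<Sum>i=1..m. L k i (x i)) (v k))
          + (conjugate (G k) (g k) (v k) + ereal (inner (v k) (r k)))
        \<le> conjugate (G k) (g k) (w k) + ereal (inner (w k) (r k))"
      by blast
  next
    have "(\<Sum>i=1..m. inner (x i) (?u w' i)) = (\<Sum>k=1..K. inner (\<Sum>i=1..m. L k i (x i)) (w' k))" for w'
      by (rule sum_adjoint[OF x])
    then show "(\<Sum>i=1..m. inner (x i) (?u v i) - inner (x i) (?u w i))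
        + (\<Sum>k=1..K. inner (\<Sum>i=1..m. L k i (x i)) (w k) - inner (\<Sum>i=1..m. L k i (x i)) (v k)) = 0"
      unfolding sum_subtractf by simp
  qed
qed

end

section \<open>Strong convergence\<close>

lemma tendsto_tuple_component:
  assumes "(\<lambda>n. tuple m (y n)) \<longlonglongrightarrow> tuple m c" "i \<in> {1..m}"
  shows "(\<lambda>n. y n i) \<longlonglongrightarrow> c i"
proof -
  have "norm (y n i - c i) \<le> norm (tuple m (y n) - tuple m c)" for n
    unfolding tuple_diff using norm_component_le_norm_tuple[OF assms(2), of "\<lambda>i. y n i - c i"] by simp
  moreover have "(\<lambda>n. norm (tuple m (y n) - tuple m c)) \<longlonglongrightarrow> 0"
    using assms(1) by (simp add: LIM_zero tendsto_norm_zero)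
  ultimately have "(\<lambda>n. y n i - c i) \<longlonglongrightarrow> 0"
    by (intro Lim_null_comparison[of "\<lambda>n. y n i - c i" "\<lambda>n. norm (tuple m (y n) - tuple m c)"]
        always_eventually allI)
  then show ?thesis
    by (simp add: LIM_zero_iff)
qed

theorem corollary4p5:
  fixes m K :: nat
    and H :: "nat \<Rightarrow> 'a::real_inner set" and G :: "nat \<Rightarrow> 'b::real_inner set"
    and f :: "nat \<Rightarrow> 'a \<Rightarrow> ereal" and g :: "nat \<Rightarrow> 'b \<Rightarrow> ereal"
    and z :: "nat \<Rightarrow> 'a" and r :: "nat \<Rightarrow> 'b"
    and L :: "nat \<Rightarrow> nat \<Rightarrow> 'a \<Rightarrow> 'b"
    and xbar :: "nat \<Rightarrow> 'a" and vbar :: "nat \<Rightarrow> 'b"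
    and \<epsilon> :: real
    and x xh a s :: "nat \<Rightarrow> nat \<Rightarrow> 'a"
    and v vh l b t :: "nat \<Rightarrow> nat \<Rightarrow> 'b"
    and \<gamma> \<mu> \<tau> \<theta> lam chi \<omega> \<nu> \<rho> :: "nat \<Rightarrow> real"
  assumes m_pos: "m \<ge> 1" and K_pos: "K \<ge> 1"
    and H: "\<And>i. i \<in> {1..m} \<Longrightarrow> hilbert_carrier (H i)"
    and G: "\<And>k. k \<in> {1..K} \<Longrightarrow> hilbert_carrier (G k)"
    and f: "\<And>i. i \<in> {1..m} \<Longrightarrow> f i \<in> Gamma0 (H i)"
    and g: "\<And>k. k \<in> {1..K} \<Longrightarrow> g k \<in> Gamma0 (G k)"
    and z: "\<And>i. i \<in> {1..m} \<Longrightarrow> z i \<in> H i"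
    and r: "\<And>k. k \<in> {1..K} \<Longrightarrow> r k \<in> G k"
    and L: "\<And>i k. i \<in> {1..m} \<Longrightarrow> k \<in> {1..K} \<Longrightarrow> bounded_linear_between (H i) (G k) (L k i)"
    and init: "(x 0, v 0) \<in> direct_sum m K H G"
    and range: "\<And>i. i \<in> {1..m} \<Longrightarrow>
          z i \<in> ran_on (\<Pi>\<^sub>E j\<in>{1..m}. H j) (coupled_operator m K H G f g L r i)"
    and best: "is_best_approx m K (kuhn_tucker_set m K H G f g L z r) (x 0, v 0) (xbar, vbar)"
    and eps: "0 < \<epsilon>" "\<epsilon> < 1"
    \<comment> \<open>step 1\<close>
    and gamma: "\<And>n. \<gamma> n \<in> {\<epsilon>..1/\<epsilon>}"
    and mu: "\<And>n. \<mu> n \<in> {\<epsilon>..1/\<epsilon>}"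
    and a: "\<And>n i. i \<in> {1..m} \<Longrightarrow>
          a n i = prox (H i) (\<lambda>y. ereal (\<gamma> n) * f i y)
                    (x n i + \<gamma> n *\<^sub>R (z i - (\<Sum>k=1..K. adjoint_on (H i) (L k i) (v n k))))"
    and l: "\<And>n k. k \<in> {1..K} \<Longrightarrow> l n k = (\<Sum>i=1..m. L k i (x n i))"
    and b: "\<And>n k. k \<in> {1..K} \<Longrightarrow>
          b n k = r k + prox (G k) (\<lambda>y. ereal (\<mu> n) * g k y) (l n k + \<mu> n *\<^sub>R v n k - r k)"
    and t: "\<And>n k. k \<in> {1..K} \<Longrightarrow> t n k = b n k - (\<Sum>i=1..m. L k i (a n i))"
    and s: "\<And>n i. i \<in> {1..m} \<Longrightarrow>
          s n i = (1 / \<gamma> n) *\<^sub>R (x n i - a n i)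
                  + (1 / \<mu> n) *\<^sub>R (\<Sum>k=1..K. adjoint_on (H i) (L k i) (l n k - b n k))"
    and tau: "\<And>n. \<tau> n = (\<Sum>i=1..m. (norm (s n i))\<^sup>2) + (\<Sum>k=1..K. (norm (t n k))\<^sup>2)"
    \<comment> \<open>step 2\<close>
    and theta_zero: "\<And>n. \<tau> n = 0 \<Longrightarrow> \<theta> n = 0"
    and lam: "\<And>n. \<tau> n > 0 \<Longrightarrow> lam n \<in> {\<epsilon>..1}"
    and theta_pos: "\<And>n. \<tau> n > 0 \<Longrightarrow>
          \<theta> n = lam n * ((1 / \<gamma> n) * (\<Sum>i=1..m. (norm (x n i - a n i))\<^sup>2)
                         + (1 / \<mu> n) * (\<Sum>k=1..K. (norm (l n k - b n k))\<^sup>2)) / \<tau> n"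
    \<comment> \<open>step 3\<close>
    and xh: "\<And>n i. i \<in> {1..m} \<Longrightarrow> xh n i = x n i - \<theta> n *\<^sub>R s n i"
    and vh: "\<And>n k. k \<in> {1..K} \<Longrightarrow> vh n k = v n k - \<theta> n *\<^sub>R t n k"
    \<comment> \<open>step 4\<close>
    and chi_eq: "\<And>n. chi n = (\<Sum>i=1..m. inner (x 0 i - x n i) (x n i - xh n i))
                        + (\<Sum>k=1..K. inner (v 0 k - v n k) (v n k - vh n k))"
    and omega: "\<And>n. \<omega> n = (\<Sum>i=1..m. (norm (x 0 i - x n i))\<^sup>2)
                          + (\<Sum>k=1..K. (norm (v 0 k - v n k))\<^sup>2)"
    and nu: "\<And>n. \<nu> n = (\<Sum>i=1..m. (norm (x n i - xh n i))\<^sup>2)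
                       + (\<Sum>k=1..K. (norm (v n k - vh n k))\<^sup>2)"
    and rho: "\<And>n. \<rho> n = \<omega> n * \<nu> n - (chi n)\<^sup>2"
    \<comment> \<open>step 5\<close>
    and x_case1: "\<And>n i. \<rho> n = 0 \<Longrightarrow> chi n \<ge> 0 \<Longrightarrow> i \<in> {1..m} \<Longrightarrow> x (Suc n) i = xh n i"
    and v_case1: "\<And>n k. \<rho> n = 0 \<Longrightarrow> chi n \<ge> 0 \<Longrightarrow> k \<in> {1..K} \<Longrightarrow> v (Suc n) k = vh n k"
    and x_case2: "\<And>n i. \<rho> n > 0 \<Longrightarrow> chi n * \<nu> n \<ge> \<rho> n \<Longrightarrow> i \<in> {1..m} \<Longrightarrow>
          x (Suc n) i = x 0 i + (1 + chi n / \<nu> n) *\<^sub>R (xh n i - x n i)"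
    and v_case2: "\<And>n k. \<rho> n > 0 \<Longrightarrow> chi n * \<nu> n \<ge> \<rho> n \<Longrightarrow> k \<in> {1..K} \<Longrightarrow>
          v (Suc n) k = v 0 k + (1 + chi n / \<nu> n) *\<^sub>R (vh n k - v n k)"
    and x_case3: "\<And>n i. \<rho> n > 0 \<Longrightarrow> chi n * \<nu> n < \<rho> n \<Longrightarrow> i \<in> {1..m} \<Longrightarrow>
          x (Suc n) i = x n i + (\<nu> n / \<rho> n) *\<^sub>R
                          (chi n *\<^sub>R (x 0 i - x n i) + \<omega> n *\<^sub>R (xh n i - x n i))"
    and v_case3: "\<And>n k. \<rho> n > 0 \<Longrightarrow> chi n * \<nu> n < \<rho> n \<Longrightarrow> k \<in> {1..K} \<Longrightarrow>
          v (Suc n) k = v n k + (\<nu> n / \<rho> n) *\<^sub>R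
                          (chi n *\<^sub>R (v 0 k - v n k) + \<omega> n *\<^sub>R (vh n k - v n k))"
  shows "(solves_primal m K H f g L z r xbar \<and> solves_dual m K H G f g L z r vbar)
    \<and> (\<forall>i\<in>{1..m}. (\<lambda>n. x n i) \<longlonglongrightarrow> xbar i)
    \<and> (\<forall>k\<in>{1..K}. (\<lambda>n. v n k) \<longlonglongrightarrow> vbar k)"
proof -
  let ?X = "tuples m H" and ?Y = "tuples K G"
  let ?Ls = "\<lambda>i w. \<Sum>k=1..K. adjoint_on (H i) (L k i) (w k)"
  define A where "A = tuple_graph m (\<lambda>i. shifted_subdifferential (H i) (f i) (z i) 0)"
  define B where "B = tuple_graph K (\<lambda>k. shifted_subdifferential (G k) (g k) 0 (r k))"
  define \<Lambda> where "\<Lambda> u = tuple K (\<lambda>k. \<Sum>i=1..m. L k i (seq_of u i))" for u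
  define \<Lambda>' where "\<Lambda>' w = tuple m (\<lambda>i. ?Ls i (seq_of w))" for w
  define Z where "Z = {(y, w). y \<in> ?X \<and> w \<in> ?Y \<and> (y, - \<Lambda>' w) \<in> A \<and> (\<Lambda> y, w) \<in> B}"
  define KT where "KT = kuhn_tucker_set m K H G f g L z r"
  interpret kt: kuhn_tucker_problem m K H G f g z r L
    by unfold_locales (fact H G f g z r L)+
  note sub = kt.subspaces
  have \<Lambda>_tuple: "\<Lambda> (tuple m h) = tuple K (\<lambda>k. \<Sum>i=1..m. L k i (h i))" for h
    unfolding \<Lambda>_def by (intro tuple_cong sum.cong) (simp_all add: seq_of_tuple)
  have \<Lambda>'_tuple: "\<Lambda>' (tuple K w) = tuple m (\<lambda>i. ?Ls i w)" for w
    unfolding \<Lambda>'_def by (intro tuple_cong sum.cong) (simp_all add: seq_of_tuple)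
  have neg_tuple: "- tuple m h = tuple m (\<lambda>i. - h i)" for h :: "nat \<Rightarrow> 'a"
    using tuple_scaleR[of "- 1" m h] by simp
  obtain C where C: "\<And>h. (\<And>i. i \<in> {1..m} \<Longrightarrow> h i \<in> H i) \<Longrightarrow>
      norm (tuple K (\<lambda>k. \<Sum>i=1..m. L k i (h i))) \<le> C * norm (tuple m h)"
    using kt.sum_L_bound by blast
  have A_max: "maximally_monotone ?X A"
    unfolding A_def
    by (intro tuple_graph_maximally_monotone shifted_subdifferential_maximally_monotone f H z subspace_0 sub)
  have B_max: "maximally_monotone ?Y B"
    unfolding B_def
    by (intro tuple_graph_maximally_monotone shifted_subdifferential_maximally_monotone g G r subspace_0 sub)
  \<comment> \<open>Tuples vanish outside their index range, whereas elements of the direct sum are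
    undefined there; \<open>restrict\<close> translates between the two conventions.\<close>
  have Z_tuple: "(tuple m y, tuple K w) \<in> Z \<longleftrightarrow> (restrict y {1..m}, restrict w {1..K}) \<in> KT" for y w
  proof -
    have restr: "?Ls i (restrict w {1..K}) = ?Ls i w"
      "(\<Sum>i=1..m. L k i (restrict y {1..m} i)) = (\<Sum>i=1..m. L k i (y i))" for i k
      by (intro sum.cong; simp)+
    have "(restrict y {1..m}, restrict w {1..K}) \<in> KT \<longleftrightarrow>
      (\<forall>i\<in>{1..m}. y i \<in> H i) \<and> (\<forall>k\<in>{1..K}. w k \<in> G k) \<and>
      (\<forall>i\<in>{1..m}. z i - ?Ls i w \<in> subdifferential (H i) (f i) (y i)) \<and>
      (\<forall>k\<in>{1..K}. w k \<in> subdifferential (G k) (g k) ((\<Sum>i=1..m. L k i (y i)) - r k))"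
      unfolding KT_def kt.kuhn_tucker_set_iff restr by (simp add: direct_sum_def PiE_iff)
    moreover have "(\<Sum>i=1..m. L k i (y i)) \<in> G k" if "\<forall>i\<in>{1..m}. y i \<in> H i" "k \<in> {1..K}" for k
      using that by (intro kt.sum_L_in) auto
    ultimately show ?thesis
      unfolding Z_def A_def B_def
      by (auto simp: \<Lambda>_tuple \<Lambda>'_tuple neg_tuple tuple_graph_iff tuple_in_tuples shifted_subdifferential_def)
  qed
  have dist: "direct_sum_dist m K (x 0, v 0) (restrict y {1..m}, restrict w {1..K})
      = norm ((tuple m (x 0), tuple K (v 0)) - (tuple m y, tuple K w))" for y w
    by (simp add: direct_sum_dist_def norm_Pair tuple_diff norm_tuple)
  have bar: "(xbar, vbar) \<in> KT" "\<And>c. c \<in> KT \<Longrightarrow> direct_sum_dist m K (x 0, v 0) (xbar, vbar) \<le> direct_sum_dist m K (x 0, v 0) c"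
    using best by (auto simp: is_best_approx_def is_arg_min_linorder KT_def)
  have bar_ext: "restrict xbar {1..m} = xbar" "restrict vbar {1..K} = vbar"
    using bar(1) by (auto simp: KT_def kuhn_tucker_set_def direct_sum_def PiE_iff intro: extensional_restrict)
  have "(\<lambda>n. (tuple m (x n), tuple K (v n))) \<longlonglongrightarrow> (tuple m xbar, tuple K vbar)"
  proof (rule primal_dual_converges[where X = ?X and Y = ?Y and \<Lambda> = \<Lambda> and \<Lambda>' = \<Lambda>' and A = A and B = B
        and C = C and Z = Z and \<epsilon> = \<epsilon> and \<gamma> = \<gamma> and \<mu> = \<mu> and \<tau> = \<tau> and \<theta> = \<theta> and lam = lam
        and a = "\<lambda>n. tuple m (a n)" and s = "\<lambda>n. tuple m (s n)" and l = "\<lambda>n. tuple K (l n)"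
        and b = "\<lambda>n. tuple K (b n)" and t = "\<lambda>n. tuple K (t n)"
        and xh = "\<lambda>n. tuple m (xh n)" and vh = "\<lambda>n. tuple K (vh n)",
        OF _ _ _ _ _ _ _ A_max B_max Z_def _ _ eps(1) gamma mu])
    show "hilbert_carrier ?X" "hilbert_carrier ?Y"
      using H G by (auto intro: hilbert_carrier_tuples)
    show "\<Lambda> ` ?X \<subseteq> ?Y"
      using kt.sum_L_in by (auto elim!: tuplesE simp: \<Lambda>_tuple tuple_in_tuples)
    show "\<Lambda>' ` ?Y \<subseteq> ?X"
      using kt.sum_adjoint_in by (auto elim!: tuplesE simp: \<Lambda>'_tuple tuple_in_tuples)
    show "\<Lambda> (y - w) = \<Lambda> y - \<Lambda> w" if "y \<in> ?X" "w \<in> ?X" for y w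
      using that kt.sum_L_diff
      by (auto elim!: tuplesE simp: \<Lambda>_tuple tuple_diff intro!: tuple_cong)
    show "norm (\<Lambda> y) \<le> C * norm y" if "y \<in> ?X" for y
      using that C by (auto elim!: tuplesE simp: \<Lambda>_tuple)
    show "inner (\<Lambda> y) w = inner y (\<Lambda>' w)" if "y \<in> ?X" "w \<in> ?Y" for y w
      using that kt.sum_adjoint by (auto elim!: tuplesE simp: \<Lambda>_tuple \<Lambda>'_tuple inner_tuple)
    show "tuple m (x 0) \<in> ?X" "tuple K (v 0) \<in> ?Y"
      using init by (auto simp: direct_sum_def tuple_in_tuples)
    show l_tuple: "tuple K (l n) = \<Lambda> (tuple m (x n))" for n
      unfolding \<Lambda>_tuple by (intro tuple_cong l)
    show "tuple K (t n) = tuple K (b n) - \<Lambda> (tuple m (a n))" for n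
      unfolding \<Lambda>_tuple tuple_diff by (intro tuple_cong t)
    show "tuple m (s n) = (1 / \<gamma> n) *\<^sub>R (tuple m (x n) - tuple m (a n)) + (1 / \<mu> n) *\<^sub>R \<Lambda>' (tuple K (l n) - tuple K (b n))" for n
      unfolding \<Lambda>'_tuple tuple_diff tuple_scaleR tuple_add by (intro tuple_cong s)
    show "\<tau> n = (norm (tuple m (s n)))\<^sup>2 + (norm (tuple K (t n)))\<^sup>2" for n
      by (simp only: tau norm_tuple)
    show "lam n \<in> {\<epsilon>..1}" if "\<tau> n > 0" for n
      by (rule lam[OF that])
    show "\<theta> n = lam n * ((1 / \<gamma> n) * (norm (tuple m (x n) - tuple m (a n)))\<^sup>2
        + (1 / \<mu> n) * (norm (tuple K (l n) - tuple K (b n)))\<^sup>2) / \<tau> n" if "\<tau> n > 0" for n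
      unfolding tuple_diff norm_tuple by (rule theta_pos[OF that])
    show "tuple m (xh n) = tuple m (x n) - \<theta> n *\<^sub>R tuple m (s n)" for n
      unfolding tuple_scaleR tuple_diff by (intro tuple_cong xh)
    show "tuple K (vh n) = tuple K (v n) - \<theta> n *\<^sub>R tuple K (t n)" for n
      unfolding tuple_scaleR tuple_diff by (intro tuple_cong vh)
    show "(tuple m xbar, tuple K vbar) \<in> Z"
      unfolding Z_tuple bar_ext by (rule bar(1))
    show "norm ((tuple m (x 0), tuple K (v 0)) - (tuple m xbar, tuple K vbar)) \<le> norm ((tuple m (x 0), tuple K (v 0)) - c)"
      if "c \<in> Z" for c
    proof -
      obtain y w where c: "c = (tuple m y, tuple K w)"
        using \<open>c \<in> Z\<close> by (auto simp: Z_def elim!: tuplesE)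
      have "(restrict y {1..m}, restrict w {1..K}) \<in> KT"
        using \<open>c \<in> Z\<close> unfolding c Z_tuple .
      from bar(2)[OF this] show ?thesis
        unfolding c dist dist[of xbar vbar, unfolded bar_ext] .
    qed
    fix n
    have pos: "0 < \<gamma> n" "0 < \<mu> n"
      using gamma[of n] mu[of n] eps by auto
    show "haugazeau_step (tuple m (x 0), tuple K (v 0)) (tuple m (x n), tuple K (v n))
        (tuple m (xh n), tuple K (vh n)) (tuple m (x (Suc n)), tuple K (v (Suc n)))"
    proof -
      have eqs: "inner ((tuple m (x 0), tuple K (v 0)) - (tuple m (x n), tuple K (v n)))
          ((tuple m (x n), tuple K (v n)) - (tuple m (xh n), tuple K (vh n))) = chi n"
        "(norm ((tuple m (x 0), tuple K (v 0)) - (tuple m (x n), tuple K (v n))))\<^sup>2 = \<omega> n"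
        "(norm ((tuple m (x n), tuple K (v n)) - (tuple m (xh n), tuple K (vh n))))\<^sup>2 = \<nu> n"
        unfolding chi_eq omega nu by (simp_all add: tuple_diff inner_tuple norm_Pair norm_tuple sum_nonneg)
      show ?thesis
        unfolding haugazeau_step_def Let_def eqs rho[symmetric]
        by (auto simp: tuple_add tuple_diff tuple_scaleR x_case1 v_case1 x_case2 v_case2 x_case3 v_case3 intro!: tuple_cong)
    qed
    assume "tuple m (x n) \<in> ?X" "tuple K (v n) \<in> ?Y"
    then have xH: "\<And>i. i \<in> {1..m} \<Longrightarrow> x n i \<in> H i" and vG: "\<And>k. k \<in> {1..K} \<Longrightarrow> v n k \<in> G k"
      by (auto simp: tuple_in_tuples)
    \<comment> \<open>The optimality condition of the proximal step, solved for the subgradient: the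
      term \<open>z i\<close> left over is the shift built into \<open>A\<close>.\<close>
    have "a n i \<in> H i \<and> (1 / \<gamma> n) *\<^sub>R (x n i - a n i) - ?Ls i (v n) + z i \<in> subdifferential (H i) (f i) (a n i)"
      if i: "i \<in> {1..m}" for i
    proof -
      have "x n i + \<gamma> n *\<^sub>R (z i - ?Ls i (v n)) \<in> H i"
        using i xH z by (intro subspace_add subspace_scale subspace_diff sub kt.sum_adjoint_in)
      note prox = prox_subdifferential[OF f[OF i] H[OF i] pos(1) this, folded a[OF i]]
      have "(1 / \<gamma> n) *\<^sub>R (x n i + \<gamma> n *\<^sub>R (z i - ?Ls i (v n)) - a n i)
          = (1 / \<gamma> n) *\<^sub>R (x n i - a n i) - ?Ls i (v n) + z i"
        using pos by (simp add: algebra_simps)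
      with prox show ?thesis
        by simp
    qed
    then show "(tuple m (a n), (1 / \<gamma> n) *\<^sub>R (tuple m (x n) - tuple m (a n)) - \<Lambda>' (tuple K (v n))) \<in> A"
      unfolding A_def \<Lambda>'_tuple tuple_diff tuple_scaleR tuple_graph_iff by (simp add: shifted_subdifferential_def)
    \<comment> \<open>The proximal point is \<open>b n k - r k\<close>; the translation by
      \<open>r k\<close> is the one built into \<open>B\<close>.\<close>
    have "b n k \<in> G k \<and> (1 / \<mu> n) *\<^sub>R (l n k - b n k) + v n k \<in> subdifferential (G k) (g k) (b n k - r k)"
      if k: "k \<in> {1..K}" for k
    proof -
      have "l n k + \<mu> n *\<^sub>R v n k - r k \<in> G k"
        unfolding l[OF k] using k xH vG r
        by (intro subspace_add subspace_scale subspace_diff sub kt.sum_L_in)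
      note prox = prox_subdifferential[OF g[OF k] G[OF k] pos(2) this]
      have br: "prox (G k) (\<lambda>y. ereal (\<mu> n) * g k y) (l n k + \<mu> n *\<^sub>R v n k - r k) = b n k - r k"
        by (simp add: b[OF k])
      have "(1 / \<mu> n) *\<^sub>R (l n k + \<mu> n *\<^sub>R v n k - r k - (b n k - r k)) = (1 / \<mu> n) *\<^sub>R (l n k - b n k) + v n k"
        using pos by (simp add: algebra_simps)
      with prox show ?thesis
        unfolding br using subspace_add[OF sub(2)[OF k] _ r[OF k], of "b n k - r k"] by simp
    qed
    then show "(tuple K (b n), (1 / \<mu> n) *\<^sub>R (tuple K (l n) - tuple K (b n)) + tuple K (v n)) \<in> B"
      unfolding B_def tuple_add tuple_diff tuple_scaleR tuple_graph_iff by (simp add: shifted_subdifferential_def)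
  qed
  then have lim: "(\<lambda>n. tuple m (x n)) \<longlonglongrightarrow> tuple m xbar" "(\<lambda>n. tuple K (v n)) \<longlonglongrightarrow> tuple K vbar"
    using tendsto_fst tendsto_snd by fastforce+
  have "(\<lambda>n. x n i) \<longlonglongrightarrow> xbar i" if "i \<in> {1..m}" for i
    by (rule tendsto_tuple_component[OF lim(1) that])
  moreover have "(\<lambda>n. v n k) \<longlonglongrightarrow> vbar k" if "k \<in> {1..K}" for k
    by (rule tendsto_tuple_component[OF lim(2) that])
  ultimately show ?thesis
    using kt.kuhn_tucker_solves_primal[OF bar(1)[unfolded KT_def]]
      kt.kuhn_tucker_solves_dual[OF bar(1)[unfolded KT_def]] by blast
qed

end
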